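(* Let $f$ be a dissipative complex Hénon map with dominated splitting in its Julia set $J$. Then $J$ is (uniformly) hyperbolic if and only if every $f$-invariant probability measure supported in $J$ is hyperbolic.
   Context: A complex (generalized) Hénon map $f:\mathbb{C}^2\to\mathbb{C}^2$ is a finite composition of maps $(x,y)\mapsto(y,p(y)-bx)$ with $p$ a polynomial of degree at least two and $b\in\mathbb{C}^*$; it is dissipative if its constant Jacobian satisfies $|\det Df|<1$. Let $K^\pm$ be the set of points with bounded forward/backward orbit, $J^\pm=\partial K^\pm$, and $J=J^+\cap J^-$. A dominated splitting in $J$ is a $Df$-invariant continuous splitting $T_J\mathbb{C}^2=E\oplus F$ into complex line bundles for which there are $C>0$, $0<\lambda<1$ with $\|Df^n|_{E(x)}\|\cdot\|Df^{-n}|_{F(f^n(x))}\|\le C\lambda^n$ for all $n\ge 0$, $x\in J$. For an $f$-invariant probability measure $\nu$ with support in $J$, let $\lambda^-(x)\le\lambda^+(x)$ be the Lyapunov exponents at $\nu$-a.e. $x$; in the dissipative case $\lambda^-(x)<0\le\lambda^+(x)$. The measure $\nu$ is hyperbolic if $\lambda^+(x)>0$ for $\nu$-a.e. $x$. *)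

theory Defs
  imports
    "HOL-Analysis.Analysis"
    "HOL-Probability.Probability"
    "HOL-Computational_Algebra.Polynomial"
begin

section \<open>Complex Henon maps\<close>

definition henon_factor :: "complex poly \<Rightarrow> complex \<Rightarrow> complex^2 \<Rightarrow> complex^2" where
  "henon_factor p b v = vector [v $ 2, poly p (v $ 2) - b * v $ 1]"

inductive henon_map :: "(complex^2 \<Rightarrow> complex^2) \<Rightarrow> bool" where
  factor: "degree p \<ge> 2 \<Longrightarrow> b \<noteq> 0 \<Longrightarrow> henon_map (henon_factor p b)"
| comp: "henon_map f \<Longrightarrow> henon_map g \<Longrightarrow> henon_map (f \<circ> g)"

text \<open>
  The real Frechet derivative of a Henon map is complex linear, so it is the holomorphic
  derivative.  In \<open>dissipative\<close> its matrix is the complex \<open>2 \<times> 2\<close> Jacobian matrix,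
  hence the determinant is the complex Jacobian.
\<close>

abbreviation Df :: "(complex^2 \<Rightarrow> complex^2) \<Rightarrow> complex^2 \<Rightarrow> complex^2 \<Rightarrow> complex^2" where
  "Df f x \<equiv> frechet_derivative f (at x)"

definition dissipative :: "(complex^2 \<Rightarrow> complex^2) \<Rightarrow> bool" where
  "dissipative f \<longleftrightarrow> (\<forall>x. cmod (det (matrix (Df f x))) < 1)"

definition K_plus :: "(complex^2 \<Rightarrow> complex^2) \<Rightarrow> (complex^2) set" where
  "K_plus f = {x. bounded (range (\<lambda>n. (f ^^ n) x))}"

definition K_minus :: "(complex^2 \<Rightarrow> complex^2) \<Rightarrow> (complex^2) set" where
  "K_minus f = {x. bounded (range (\<lambda>n. (inv f ^^ n) x))}"

definition J_plus :: "(complex^2 \<Rightarrow> complex^2) \<Rightarrow> (complex^2) set" where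
  "J_plus f = frontier (K_plus f)"

definition J_minus :: "(complex^2 \<Rightarrow> complex^2) \<Rightarrow> (complex^2) set" where
  "J_minus f = frontier (K_minus f)"

definition julia :: "(complex^2 \<Rightarrow> complex^2) \<Rightarrow> (complex^2) set" where
  "julia f = J_plus f \<inter> J_minus f"

section \<open>Splittings of the tangent bundle\<close>

text \<open>Operator norm of a linear map restricted to a subspace; \<open>onorm A = onorm_on UNIV A\<close>.\<close>

definition onorm_on :: "(complex^2) set \<Rightarrow> (complex^2 \<Rightarrow> complex^2) \<Rightarrow> real" where
  "onorm_on V A = (SUP v\<in>V. norm (A v) / norm v)"

text \<open>
  Splittings into complex subspaces.  The matrix \<open>P x\<close> is the projection onto \<open>E x\<close> along
  \<open>F x\<close>; its continuity in \<open>x\<close> is continuity of the splitting.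
\<close>

definition continuous_splitting ::
  "(complex^2) set \<Rightarrow> (complex^2 \<Rightarrow> (complex^2) set) \<Rightarrow> (complex^2 \<Rightarrow> (complex^2) set) \<Rightarrow> bool" where
  "continuous_splitting S E F \<longleftrightarrow>
    (\<forall>x\<in>S. vec.subspace (E x) \<and> vec.subspace (F x) \<and>
      E x \<inter> F x = {0} \<and> {u + v | u v. u \<in> E x \<and> v \<in> F x} = UNIV) \<and>
    (\<exists>P :: complex^2 \<Rightarrow> complex^2^2. continuous_on S P \<and>
      (\<forall>x\<in>S. \<forall>u\<in>E x. \<forall>v\<in>F x. P x *v (u + v) = u))"

definition invariant_splitting ::
  "(complex^2 \<Rightarrow> complex^2) \<Rightarrow> (complex^2) set \<Rightarrow>
    (complex^2 \<Rightarrow> (complex^2) set) \<Rightarrow> (complex^2 \<Rightarrow> (complex^2) set) \<Rightarrow> bool" where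
  "invariant_splitting f S E F \<longleftrightarrow> continuous_splitting S E F \<and>
    (\<forall>x\<in>S. Df f x ` E x = E (f x) \<and> Df f x ` F x = F (f x))"

definition has_dominated_splitting :: "(complex^2 \<Rightarrow> complex^2) \<Rightarrow> (complex^2) set \<Rightarrow> bool" where
  "has_dominated_splitting f S \<longleftrightarrow>
    (\<exists>E F. invariant_splitting f S E F \<and>
      (\<forall>x\<in>S. vec.dim (E x) = 1 \<and> vec.dim (F x) = 1) \<and>
      (\<exists>C lam. C > 0 \<and> 0 < lam \<and> lam < 1 \<and>
        (\<forall>x\<in>S. \<forall>n. onorm_on (E x) (Df (f ^^ n) x) *
          onorm_on (F ((f ^^ n) x)) (Df (inv f ^^ n) ((f ^^ n) x)) \<le> C * lam ^ n)))"

text \<open>As usual for hyperbolic sets, the dimensions of the two subspaces are not prescribed.\<close>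

definition uniformly_hyperbolic :: "(complex^2 \<Rightarrow> complex^2) \<Rightarrow> (complex^2) set \<Rightarrow> bool" where
  "uniformly_hyperbolic f S \<longleftrightarrow>
    (\<exists>Es Eu. invariant_splitting f S Es Eu \<and>
      (\<exists>C lam. C > 0 \<and> 0 < lam \<and> lam < 1 \<and>
        (\<forall>x\<in>S. \<forall>n. onorm_on (Es x) (Df (f ^^ n) x) \<le> C * lam ^ n \<and>
          onorm_on (Eu x) (Df (inv f ^^ n) x) \<le> C * lam ^ n)))"

section \<open>Invariant measures and Lyapunov exponents\<close>

definition invariant_probability ::
  "(complex^2 \<Rightarrow> complex^2) \<Rightarrow> (complex^2) measure \<Rightarrow> bool" where
  "invariant_probability f \<nu> \<longleftrightarrow> prob_space \<nu> \<and> sets \<nu> = sets borel \<and> distr \<nu> borel f = \<nu>"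

definition measure_support :: "(complex^2) measure \<Rightarrow> (complex^2) set" where
  "measure_support \<nu> = {x. \<forall>U. open U \<longrightarrow> x \<in> U \<longrightarrow> emeasure \<nu> U > 0}"

definition lyapunov_exponent ::
  "(complex^2 \<Rightarrow> complex^2) \<Rightarrow> complex^2 \<Rightarrow> complex^2 \<Rightarrow> ereal" where
  "lyapunov_exponent f x v = limsup (\<lambda>n. ereal (ln (norm (Df (f ^^ n) x v)) / real n))"

text \<open>
  For fixed \<open>x\<close> the exponent takes at most two values on nonzero vectors, the Lyapunov
  exponents at \<open>x\<close>; the infimum and the supremum below are the smaller and the larger one.
  By the Oseledets theorem the upper limit is a limit at almost every point for every
  invariant probability measure of compact support.
\<close>

definition lyap_minus :: "(complex^2 \<Rightarrow> complex^2) \<Rightarrow> complex^2 \<Rightarrow> ereal" where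
  "lyap_minus f x = (INF v\<in>-{0}. lyapunov_exponent f x v)"

definition lyap_plus :: "(complex^2 \<Rightarrow> complex^2) \<Rightarrow> complex^2 \<Rightarrow> ereal" where
  "lyap_plus f x = (SUP v\<in>-{0}. lyapunov_exponent f x v)"

definition hyperbolic_measure ::
  "(complex^2 \<Rightarrow> complex^2) \<Rightarrow> (complex^2) measure \<Rightarrow> bool" where
  "hyperbolic_measure f \<nu> \<longleftrightarrow> (AE x in \<nu>. lyap_plus f x > 0)"

end

theory Submission
  imports Defs "HOL-Computational_Algebra.Fundamental_Theorem_Algebra"
begin

text \<open>
\<^bold>\<open>Idea of the proof.\<close>  The Julia set \<open>J\<close> is compact and \<open>f\<close> maps it onto itself: two families of
cones at infinity are expanded by \<open>f\<close> and by its inverse, so they contain no bounded forward,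
respectively backward, orbits.  Let \<open>E \<oplus> F\<close> be the dominated splitting.

\<^bold>\<open>Contraction of E\<close> (\<open>E_contracted\<close>) comes from dissipativity and domination.  The angle between \<open>E\<close> and \<open>F\<close> is bounded
below on \<open>J\<close>, so up to a constant the product of the growth of \<open>Df^n\<close> on \<open>E\<close> and on \<open>F\<close> is the
growth of area, which is at most \<open>d^n\<close> with \<open>d < 1\<close>.  Their quotient is at most \<open>C \<lambda>^n\<close> by
domination.  Multiplying, the square of the growth on \<open>E\<close> decays exponentially.

\<^bold>\<open>Expansion of F\<close> (\<open>uniform_expansion\<close>).  Let \<open>\<phi>\<close> be the logarithm of the expansion of \<open>Df\<close> on \<open>F\<close>,
a continuous function on \<open>J\<close>; \<open>F\<close> is uniformly expanded as soon as for some \<open>N\<close> the sum of \<open>\<phi>\<close>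
over \<open>N\<close> consecutive points of an orbit in \<open>J\<close> is always positive.  Otherwise there are orbit
segments of every length with nonpositive sum, and \<open>krylov_bogolyubov\<close> turns them into an
invariant probability measure on \<open>J\<close> for which \<open>\<phi>\<close> has integral at most \<open>0\<close>.  By domination the
larger Lyapunov exponent at a point is at most the upper limit of the averages of \<open>\<phi>\<close>.  So if this measure
is hyperbolic, that upper limit is positive almost everywhere, and the maximal ergodic theorem
(\<open>integral_pos_of_limsup_average_pos\<close>) makes the integral of \<open>\<phi>\<close> positive, a contradiction.

\<^bold>\<open>Converse.\<close>  If \<open>J\<close> is uniformly hyperbolic, a nonzero unstable vector at a point has positive
exponent.  Nonzero unstable vectors exist at every point of \<open>J\<close>: if there are none at \<open>x\<close>, then all directions
are contracted along the orbit of \<open>x\<close>, hence a neighbourhood of \<open>x\<close> follows this orbit and has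
bounded forward orbits (\<open>attracting_interior\<close>), although \<open>x\<close> is a boundary point of \<open>K_plus f\<close>.
\<close>

section \<open>Measures from positive functionals on a compact set\<close>

text \<open>
The functional acts on functions continuous on the whole space, but positivity is tested on the
compact set \<open>S\<close> only.  Hence it depends only on restrictions to \<open>S\<close>.
\<close>

locale normalized_positive_functional =
  fixes S :: "'a::metric_space set" and L :: "('a \<Rightarrow> real) \<Rightarrow> real"
  assumes compact: "compact S"
    and add: "\<And>g h. continuous_on UNIV g \<Longrightarrow> continuous_on UNIV h \<Longrightarrow>
      L (\<lambda>x. g x + h x) = L g + L h"
    and scale: "\<And>c g. continuous_on UNIV g \<Longrightarrow> L (\<lambda>x. c * g x) = c * L g"
    and nonneg: "\<And>g. continuous_on UNIV g \<Longrightarrow> (\<And>x. x \<in> S \<Longrightarrow> 0 \<le> g x) \<Longrightarrow> 0 \<le> L g"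
    and one: "L (\<lambda>_. 1) = 1"
begin

lemma const: "L (\<lambda>_. c) = c"
  using scale[of "\<lambda>_. 1" c] one by simp

lemma diff:
  assumes "continuous_on UNIV g" "continuous_on UNIV h"
  shows "L (\<lambda>x. g x - h x) = L g - L h"
proof -
  have "L (\<lambda>x. g x + (-1) * h x) = L g + L (\<lambda>x. (-1) * h x)"
    by (intro add continuous_intros assms)
  also have "L (\<lambda>x. (-1) * h x) = (-1) * L h" by (intro scale assms)
  finally show ?thesis by simp
qed

lemma mono:
  assumes "continuous_on UNIV g" "continuous_on UNIV h" "\<And>x. x \<in> S \<Longrightarrow> g x \<le> h x"
  shows "L g \<le> L h"
proof -
  have "0 \<le> L (\<lambda>x. h x - g x)"
    by (intro nonneg continuous_intros assms) (use assms in auto)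
  then show ?thesis using diff assms by simp
qed

lemma sum:
  assumes "\<And>i. i \<in> I \<Longrightarrow> continuous_on UNIV (g i)"
  shows "L (\<lambda>x. \<Sum>i\<in>I. g i x) = (\<Sum>i\<in>I. L (g i))"
proof (cases "finite I")
  case True
  then show ?thesis using assms
  proof (induction I)
    case empty then show ?case by (simp add: const)
  next
    case (insert i I)
    have "L (\<lambda>x. g i x + (\<Sum>i\<in>I. g i x)) = L (g i) + L (\<lambda>x. \<Sum>i\<in>I. g i x)"
      by (intro add continuous_intros) (use insert in auto)
    then show ?case using insert by simp
  qed
qed (simp add: const)

text \<open>
Sets are covered by countable families of continuous functions rather than by open sets: then
countable subadditivity of the least cost of a cover is a reindexing, multiplication by continuous
weights splits covers, and a map of \<open>S\<close> that preserves \<open>L\<close> acts on covers.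
\<close>
definition admissible :: "(nat \<Rightarrow> 'a \<Rightarrow> real) \<Rightarrow> 'a set \<Rightarrow> bool" where
  "admissible g A \<longleftrightarrow> (\<forall>n. continuous_on UNIV (g n) \<and> (\<forall>x\<in>S. 0 \<le> g n x)) \<and>
    (\<forall>x\<in>A \<inter> S. 1 \<le> (\<Sum>n. ennreal (g n x)))"

definition outer :: "'a set \<Rightarrow> ennreal" where
  "outer A = (INF g\<in>{g. admissible g A}. \<Sum>n. ennreal (L (g n)))"

lemma outer_le: "admissible g A \<Longrightarrow> outer A \<le> (\<Sum>n. ennreal (L (g n)))"
  unfolding outer_def by (rule INF_lower) simp

lemma outer_le_single:
  assumes "continuous_on UNIV g" "\<And>x. x \<in> S \<Longrightarrow> 0 \<le> g x" "\<And>x. x \<in> A \<inter> S \<Longrightarrow> 1 \<le> g x"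
  shows "outer A \<le> ennreal (L g)"
proof -
  define G where "G n = (if n = 0 then g else (\<lambda>_. 0))" for n :: nat
  have s: "(\<Sum>n. ennreal (G n x)) = ennreal (g x)" for x
    by (subst suminf_finite[of "{0}"]) (auto simp: G_def)
  have "admissible G A"
    unfolding admissible_def s using assms
    by (auto simp: G_def simp flip: ennreal_1 intro!: ennreal_leI)
  from outer_le[OF this] show ?thesis
    by (subst (asm) suminf_finite[of "{0}"]) (auto simp: G_def const)
qed

lemma outer_le_double:
  assumes "\<And>i j. continuous_on UNIV (g i j)" "\<And>i j x. x \<in> S \<Longrightarrow> 0 \<le> g i j x"
    and "\<And>x. x \<in> A \<inter> S \<Longrightarrow> 1 \<le> (\<Sum>i. \<Sum>j. ennreal (g i j x))"
  shows "outer A \<le> (\<Sum>i. \<Sum>j. ennreal (L (g i j)))"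
proof -
  define G where "G n = (case prod_decode n of (i, j) \<Rightarrow> g i j)" for n
  have e: "(\<Sum>n. ennreal (G n x)) = (\<Sum>i. \<Sum>j. ennreal (g i j x))" for x
    using suminf_ennreal_2dimen[where f="\<lambda>(i,j). ennreal (g i j x)"
        and g="\<lambda>i. \<Sum>j. ennreal (g i j x)"]
    by (simp add: G_def case_prod_beta)
  have "admissible G A"
    unfolding admissible_def e using assms by (auto simp: G_def split: prod.splits)
  from outer_le[OF this] show ?thesis
    using suminf_ennreal_2dimen[where f="\<lambda>(i,j). ennreal (L (g i j))"
        and g="\<lambda>i. \<Sum>j. ennreal (L (g i j))"]
    by (simp add: G_def case_prod_beta)
qed

lemma outer_mono: "A \<subseteq> B \<Longrightarrow> outer A \<le> outer B"
  unfolding outer_def by (rule INF_superset_mono) (auto simp: admissible_def)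

lemma outer_le_1: "outer A \<le> 1"
  using outer_le_single[of "\<lambda>_. 1" A] one by simp

lemma outer_null: "A \<inter> S = {} \<Longrightarrow> outer A = 0"
  using outer_le_single[of "\<lambda>_. 0" A] const by simp

text \<open>
By compactness, finitely many members of a cover already have sum above \<open>1 - e\<close> on \<open>S\<close>, so
the cost of a cover of \<open>S\<close> is at least \<open>1\<close>.
\<close>
lemma outer_UNIV: "outer UNIV = 1"
proof (rule antisym[OF outer_le_1])
  show "1 \<le> outer UNIV" unfolding outer_def
  proof (rule INF_greatest, clarsimp)
    fix g assume g: "admissible g UNIV"
    have cont: "continuous_on UNIV (g n)" and nn: "x \<in> S \<Longrightarrow> 0 \<le> g n x" for n x
      using g by (auto simp: admissible_def)
    have Lnn: "0 \<le> L (g n)" for n by (intro nonneg cont nn)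
    show "1 \<le> (\<Sum>n. ennreal (L (g n)))"
    proof (rule ennreal_le_epsilon)
      fix e :: real assume e: "0 < e"
      define U where "U N = {x. (\<Sum>n<N. g n x) > 1 - e}" for N
      have "open (U N)" for N unfolding U_def
        by (intro open_Collect_less continuous_intros cont)
      moreover have "S \<subseteq> (\<Union>N\<in>UNIV. U N)"
      proof
        fix x assume x: "x \<in> S"
        have "1 \<le> (\<Sum>n. ennreal (g n x))" using g x by (auto simp: admissible_def)
        then have "ennreal (1 - e) < (SUP N. \<Sum>n<N. ennreal (g n x))"
          unfolding suminf_eq_SUP[symmetric] using e
          by (metis ennreal_1 ennreal_less_iff le_less_trans not_le diff_less_eq less_add_same_cancel1 
              order.strict_trans2 ennreal_lessI zero_less_one)
        then obtain N where "ennreal (1 - e) < (\<Sum>n<N. ennreal (g n x))"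
          by (auto simp: less_SUP_iff)
        also have "\<dots> = ennreal (\<Sum>n<N. g n x)" using nn x by (intro sum_ennreal) auto
        finally have "x \<in> U N" unfolding U_def
          by (metis ennreal_leI mem_Collect_eq not_le)
        then show "x \<in> (\<Union>N\<in>UNIV. U N)" by blast
      qed
      ultimately obtain F where F: "finite F" "S \<subseteq> (\<Union>N\<in>F. U N)"
        using compactE_image[OF compact, of UNIV U] by metis
      define N where "N = Max (insert 0 F)"
      have le: "1 - e \<le> (\<Sum>n<N. g n x)" if x: "x \<in> S" for x
      proof -
        obtain M where M: "M \<in> F" "x \<in> U M" using F x by auto
        then have "M \<le> N" using F by (auto simp: N_def)
        then have "(\<Sum>n<M. g n x) \<le> (\<Sum>n<N. g n x)"
          using nn x by (intro sum_mono2) auto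
        then show ?thesis using M by (auto simp: U_def)
      qed
      have "1 - e = L (\<lambda>_. 1 - e)" by (simp add: const)
      also have "\<dots> \<le> L (\<lambda>x. \<Sum>n<N. g n x)"
        by (intro mono continuous_intros cont le)
      also have "\<dots> = (\<Sum>n<N. L (g n))" by (intro sum cont)
      finally have "ennreal 1 \<le> ennreal ((\<Sum>n<N. L (g n)) + e)" by (intro ennreal_leI) simp
      also have "\<dots> = (\<Sum>n<N. ennreal (L (g n))) + ennreal e"
        using e Lnn by (simp add: sum_nonneg)
      also have "\<dots> \<le> (\<Sum>n. ennreal (L (g n))) + ennreal e"
        by (intro add_right_mono sum_le_suminf) auto
      finally show "1 \<le> (\<Sum>n. ennreal (L (g n))) + ennreal e" by simp
    qed
  qed
qed

lemma outer_measure_space: "outer_measure_space (Pow UNIV) outer"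
  unfolding outer_measure_space_def positive_def increasing_def countably_subadditive_def
proof (intro conjI allI impI ballI outer_mono)
  show "outer {} = 0" by (rule outer_null) simp
next
  fix A :: "nat \<Rightarrow> 'a set"
  show "outer (\<Union>i. A i) \<le> (\<Sum>i. outer (A i))"
  proof (rule ennreal_le_epsilon)
    fix e :: real assume e: "0 < e"
    have "\<exists>g. admissible g (A i) \<and> (\<Sum>n. ennreal (L (g n))) < outer (A i) + ennreal (e * (1/2)^Suc i)" for i
    proof -
      have "outer (A i) \<noteq> \<top>" using outer_le_1[of "A i"] by (metis ennreal_one_less_top not_le)
      then have "outer (A i) < outer (A i) + ennreal (e * (1/2)^Suc i)"
        using e by (cases "outer (A i)") (auto simp flip: ennreal_plus simp: ennreal_less_iff)
      then show ?thesis unfolding outer_def INF_less_iff by auto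
    qed
    then obtain G where G: "\<And>i. admissible (G i) (A i)"
      "\<And>i. (\<Sum>n. ennreal (L (G i n))) < outer (A i) + ennreal (e * (1/2)^Suc i)" by metis
    have "outer (\<Union>i. A i) \<le> (\<Sum>i. \<Sum>n. ennreal (L (G i n)))"
    proof (rule outer_le_double)
      fix x assume "x \<in> (\<Union>i. A i) \<inter> S"
      then obtain i where "x \<in> A i \<inter> S" by auto
      then have "1 \<le> (\<Sum>n. ennreal (G i n x))" using G(1)[of i] by (auto simp: admissible_def)
      also have "\<dots> \<le> (\<Sum>i. \<Sum>n. ennreal (G i n x))"
        using sum_le_suminf[of "\<lambda>i. \<Sum>n. ennreal (G i n x)" "{i}"] by simp
      finally show "1 \<le> (\<Sum>i. \<Sum>n. ennreal (G i n x))" .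
    qed (use G(1) in \<open>auto simp: admissible_def\<close>)
    also have "\<dots> \<le> (\<Sum>i. outer (A i) + ennreal (e * (1/2)^Suc i))"
      by (intro suminf_le less_imp_le[OF G(2)]) auto
    also have "\<dots> = (\<Sum>i. outer (A i)) + (\<Sum>i. ennreal (e * (1/2)^Suc i))"
      by (rule suminf_add[symmetric]) auto
    also have "(\<Sum>i. ennreal (e * (1/2)^Suc i)) = ennreal e"
      using e sums_mult[OF power_half_series, of e]
      by (intro suminf_ennreal_eq) auto
    finally show "outer (\<Union>i. A i) \<le> (\<Sum>i. outer (A i)) + ennreal e" .
  qed
qed auto

text \<open>
A cover \<open>g\<close> of \<open>X\<close> is split by continuous weights.  The functions \<open>h k\<close> decrease from \<open>1\<close> to the
indicator of \<open>C\<close>.  So \<open>h K * g\<close> covers \<open>C \<inter> X\<close> for every \<open>K\<close>, the products of \<open>g\<close> with all the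
differences \<open>h k - h (k + 1)\<close> cover \<open>X - C\<close>, and the costs of \<open>h K * g\<close> and of the first \<open>K\<close>
differences add up to the cost of \<open>g\<close>.
\<close>
lemma closed_in_lambda_system:
  assumes C: "closed C" "C \<noteq> {}"
  shows "C \<in> lambda_system UNIV (Pow UNIV) outer"
  unfolding lambda_system_def
proof (clarify, intro conjI ballI)
  show "C \<in> Pow UNIV" by simp
  fix X :: "'a set" assume "X \<in> Pow UNIV"
  define h where "h k x = max 0 (1 - real k * infdist x C)" for k x
  have h: "continuous_on UNIV (h k)" for k
    unfolding h_def by (intro continuous_intros)
  have h0: "h 0 x = 1" and hnn: "0 \<le> h k x" and hC: "x \<in> C \<Longrightarrow> h k x = 1" for k x
    by (auto simp: h_def)
  have hmono: "h (Suc k) x \<le> h k x" for k x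
  proof -
    have "real k * infdist x C \<le> real (Suc k) * infdist x C"
      by (intro mult_right_mono infdist_nonneg) auto
    then show ?thesis by (auto simp: h_def)
  qed
  have tel: "(\<Sum>k<K. h k x - h (Suc k) x) = h 0 x - h K x" for K x
    by (rule sum_lessThan_telescope')
  have tele: "(\<Sum>k. ennreal (h k x - h (Suc k) x)) = 1" if "x \<notin> C" for x
  proof -
    have pos: "infdist x C > 0" using C that
      by (metis in_closed_iff_infdist_zero infdist_nonneg less_eq_real_def)
    obtain K :: nat where K: "1 < real K * infdist x C" using pos reals_Archimedean3 by blast
    have z: "h k x = 0" if "K \<le> k" for k
    proof -
      have "real K * infdist x C \<le> real k * infdist x C" using that pos by auto
      then show ?thesis using K by (auto simp: h_def)
    qed
    have "(\<Sum>k. ennreal (h k x - h (Suc k) x)) = (\<Sum>k<K. ennreal (h k x - h (Suc k) x))"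
      by (rule suminf_finite) (auto simp: z)
    also have "\<dots> = ennreal (\<Sum>k<K. h k x - h (Suc k) x)"
      by (intro sum_ennreal) (use hmono in auto)
    finally show ?thesis by (simp add: tel h0 z)
  qed
  have "outer (C \<inter> X) + outer ((UNIV - C) \<inter> X) \<le> outer X"
    unfolding outer_def[of X]
  proof (rule INF_greatest, clarsimp)
    fix g assume g: "admissible g X"
    have cont: "continuous_on UNIV (g n)" and nn: "x \<in> S \<Longrightarrow> 0 \<le> g n x" for n x
      using g by (auto simp: admissible_def)
    define d where "d n k x = (h k x - h (Suc k) x) * g n x" for n k x
    have dc: "continuous_on UNIV (d n k)" for n k
      unfolding d_def by (intro continuous_intros h cont)
    have dnn: "x \<in> S \<Longrightarrow> 0 \<le> d n k x" for n k x
      unfolding d_def using hmono nn by simp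
    have Ldnn: "0 \<le> L (d n k)" for n k by (intro nonneg dc dnn)
    have *: "outer ((UNIV - C) \<inter> X) \<le> (\<Sum>n. \<Sum>k. ennreal (L (d n k)))"
    proof (rule outer_le_double[OF dc dnn])
      fix x assume x: "x \<in> (UNIV - C) \<inter> X \<inter> S"
      have "(\<Sum>k. ennreal (d n k x)) = ennreal (g n x)" for n
      proof -
        have "(\<Sum>k. ennreal (d n k x)) = (\<Sum>k. ennreal (h k x - h (Suc k) x) * ennreal (g n x))"
          unfolding d_def using x nn[of x n] hmono by (intro suminf_cong ennreal_mult) auto
        then show ?thesis using x tele[of x] by simp
      qed
      then show "1 \<le> (\<Sum>n. \<Sum>k. ennreal (d n k x))" using g x by (auto simp: admissible_def)
    qed
    have part: "outer (C \<inter> X) + (\<Sum>n. \<Sum>k<K. ennreal (L (d n k))) \<le> (\<Sum>n. ennreal (L (g n)))" for K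
    proof -
      have hgnn: "0 \<le> L (\<lambda>x. h K x * g n x)" for n
        by (intro nonneg continuous_intros h cont) (use hnn nn in auto)
      have "outer (C \<inter> X) \<le> (\<Sum>n. ennreal (L (\<lambda>x. h K x * g n x)))"
        by (rule outer_le) (use g hnn in \<open>auto simp: admissible_def hC intro!: continuous_intros h\<close>)
      then have "outer (C \<inter> X) + (\<Sum>n. \<Sum>k<K. ennreal (L (d n k)))
        \<le> (\<Sum>n. ennreal (L (\<lambda>x. h K x * g n x))) + (\<Sum>n. \<Sum>k<K. ennreal (L (d n k)))"
        by (rule add_right_mono)
      also have "\<dots> = (\<Sum>n. ennreal (L (\<lambda>x. h K x * g n x)) + (\<Sum>k<K. ennreal (L (d n k))))"
        by (rule suminf_add) auto
      also have "\<dots> = (\<Sum>n. ennreal (L (g n)))"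
      proof (rule suminf_cong)
        fix n
        have "(\<Sum>k<K. L (d n k)) = L (\<lambda>x. \<Sum>k<K. d n k x)" by (rule sum[symmetric]) (rule dc)
        also have "(\<lambda>x. \<Sum>k<K. d n k x) = (\<lambda>x. (h 0 x - h K x) * g n x)"
          unfolding d_def sum_distrib_right[symmetric] by (simp only: tel)
        also have "\<dots> = (\<lambda>x. g n x - h K x * g n x)" by (simp add: h0 left_diff_distrib)
        also have "L \<dots> = L (g n) - L (\<lambda>x. h K x * g n x)"
          by (intro diff continuous_intros h cont)
        finally have "L (\<lambda>x. h K x * g n x) + (\<Sum>k<K. L (d n k)) = L (g n)" by simp
        then show "ennreal (L (\<lambda>x. h K x * g n x)) + (\<Sum>k<K. ennreal (L (d n k))) = ennreal (L (g n))"
          using hgnn Ldnn by (metis ennreal_plus sum_ennreal sum_nonneg)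
      qed
      finally show ?thesis .
    qed
    have "(\<Sum>n. \<Sum>k. ennreal (L (d n k))) = (SUP K. \<Sum>n. \<Sum>k<K. ennreal (L (d n k)))"
      unfolding suminf_eq_SUP[of "\<lambda>k. ennreal (L (d _ k))"]
      by (rule ennreal_suminf_SUP_eq) (auto intro!: incseq_SucI)
    then have "outer (C \<inter> X) + (\<Sum>n. \<Sum>k. ennreal (L (d n k))) =
       (SUP K. outer (C \<inter> X) + (\<Sum>n. \<Sum>k<K. ennreal (L (d n k))))"
      by (simp add: ennreal_SUP_add_right)
    also have "\<dots> \<le> (\<Sum>n. ennreal (L (g n)))" by (rule SUP_least) (rule part)
    finally show "outer (C \<inter> X) + outer ((UNIV - C) \<inter> X) \<le> (\<Sum>n. ennreal (L (g n)))"
      using * by (meson add_left_mono order_trans)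
  qed
  moreover have "outer X \<le> outer (C \<inter> X) + outer ((UNIV - C) \<inter> X)"
  proof -
    define A where "A i = (if i = 0 then C \<inter> X else if i = 1 then (UNIV - C) \<inter> X else {})" for i :: nat
    have "X = (\<Union>i. A i)" by (force simp: A_def split: if_splits)
    moreover have "disjoint_family A" by (auto simp: disjoint_family_on_def A_def)
    ultimately have "outer X \<le> (\<Sum>i. outer (A i))"
      using outer_measure_space
      unfolding outer_measure_space_def countably_subadditive_def by simp
    also have "\<dots> = (\<Sum>i\<in>{0,1}. outer (A i))"
      by (rule suminf_finite) (auto simp: A_def outer_null)
    finally show ?thesis by (simp add: A_def)
  qed
  ultimately show "outer (C \<inter> X) + outer ((UNIV - C) \<inter> X) = outer X" by (rule antisym)
qed

definition riesz_measure :: "'a measure" where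
  "riesz_measure = measure_of UNIV (sets borel) outer"

lemma borel_subset_lambda_system: "sets borel \<subseteq> lambda_system UNIV (Pow UNIV) outer"
proof -
  interpret P: sigma_algebra UNIV "Pow (UNIV :: 'a set)" by (rule sigma_algebra_Pow)
  interpret M: sigma_algebra UNIV "lambda_system UNIV (Pow UNIV) outer"
    using P.caratheodory_lemma[OF outer_measure_space] by (simp add: measure_space_def)
  have "S \<in> lambda_system UNIV (Pow UNIV) outer" if "open S" for S
  proof (cases "S = UNIV")
    case False
    then have "- S \<in> lambda_system UNIV (Pow UNIV) outer"
      using that by (intro closed_in_lambda_system) auto
    then show ?thesis using M.compl_sets by fastforce
  qed (use M.top in simp)
  then have "sigma_sets UNIV (Collect open) \<subseteq> lambda_system UNIV (Pow UNIV) outer"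
    by (intro M.sigma_sets_subset) blast
  then show ?thesis by (simp add: borel_def)
qed

lemma sets_riesz_measure [simp, measurable_cong]: "sets riesz_measure = sets borel"
  unfolding riesz_measure_def by (metis sets.sets_measure_of_eq space_borel)

lemma space_riesz_measure [simp]: "space riesz_measure = UNIV"
  using sets_eq_imp_space_eq[OF sets_riesz_measure] by simp

lemma emeasure_riesz_measure: "A \<in> sets borel \<Longrightarrow> emeasure riesz_measure A = outer A"
proof -
  interpret P: sigma_algebra UNIV "Pow (UNIV :: 'a set)" by (rule sigma_algebra_Pow)
  have "measure_space UNIV (sets borel) outer"
    using P.caratheodory_lemma[OF outer_measure_space] 
    by (rule measure_down)
       (metis sets.sigma_algebra_axioms space_borel, rule borel_subset_lambda_system)
  then show "A \<in> sets borel \<Longrightarrow> emeasure riesz_measure A = outer A"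
    unfolding riesz_measure_def
    by (intro emeasure_measure_of_sigma) (auto simp: measure_space_def)
qed

lemma prob_space_riesz_measure: "prob_space riesz_measure"
  by standard (simp add: emeasure_riesz_measure outer_UNIV)

lemma riesz_measure_null: "emeasure riesz_measure (- S) = 0"
  using compact by (simp add: emeasure_riesz_measure outer_null compact_imp_closed borel_open open_Compl)

text \<open>
Cut \<open>g\<close> into \<open>N\<close> horizontal layers \<open>G i\<close> of height \<open>1 / N\<close>.  The function \<open>N * G i\<close> covers the
superlevel set \<open>A i\<close> on which layer \<open>i\<close> is full, which bounds the measure of \<open>A i\<close>; and \<open>g\<close>
exceeds the normalised sum of the indicators of the \<open>A i\<close> by at most \<open>1 / N\<close>.
\<close>
lemma integral_riesz_measure_le_unit:
  assumes g: "continuous_on UNIV g" "\<And>x. 0 \<le> g x" "\<And>x. g x \<le> 1"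
  shows "(\<integral>x. g x \<partial>riesz_measure) \<le> L g"
proof -
  interpret prob_space riesz_measure by (rule prob_space_riesz_measure)
  have gm [measurable]: "g \<in> borel_measurable borel" using g(1) by (rule borel_measurable_continuous_onI)
  have gi: "integrable riesz_measure g"
    by (rule integrable_const_bound[of _ 1]) (use g in auto)
  have main: "(\<integral>x. g x \<partial>riesz_measure) \<le> L g + 1 / real N" if N: "N > 0" for N :: nat
  proof -
    define G where "G i x = max 0 (min (1 / N) (g x - real i / N))" for i x
    define A where "A i = {x. (real i + 1) / N \<le> g x}" for i :: nat
    have Gc: "continuous_on UNIV (G i)" for i unfolding G_def by (intro continuous_intros g)
    have [measurable]: "A i \<in> sets borel" for i unfolding A_def by measurable
    have up: "(\<Sum>i<m. G i x) = min (real m / N) (g x)" for m x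
    proof (induction m)
      case 0 then show ?case using g by simp
    next
      case (Suc m)
      have *: "min p y + max 0 (min e (y - p)) = min (p + e) y" if "e > 0" for p e y :: real
        using that by (auto simp: min_def max_def)
      have "real (Suc m) / N = real m / N + 1 / N" by (simp add: add_divide_distrib)
      then show ?case using Suc *[of "1 / N" "real m / N" "g x"] N by (simp add: G_def)
    qed
    have low: "min (real m / N) (g x - 1 / N) \<le> (\<Sum>i<m. (1 / N) * indicator (A i) x)" for m x
    proof (induction m)
      case 0 then show ?case by simp
    next
      case (Suc m)
      have *: "min (p + e) (y - e) \<le> s + e * of_bool (p + e \<le> y)"
        if "min p (y - e) \<le> s" "e > 0" for p e y s :: real
        using that by (auto simp: min_def split: if_splits)
      have "real (Suc m) / N = real m / N + 1 / N" "(real m + 1) / N = real m / N + 1 / N"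
        by (simp_all add: add_divide_distrib)
      then show ?case using *[OF Suc] N by (simp add: A_def indicator_def)
    qed
    have mA: "measure riesz_measure (A i) \<le> N * L (G i)" for i
    proof -
      have "outer (A i) \<le> ennreal (L (\<lambda>x. N * G i x))"
      proof (rule outer_le_single)
        show "continuous_on UNIV (\<lambda>x. N * G i x)" by (intro continuous_intros Gc)
        show "0 \<le> N * G i x" for x by (simp add: G_def)
        fix x assume "x \<in> A i \<inter> S"
        then have "G i x = 1 / N" using N by (auto simp: G_def A_def add_divide_distrib)
        then show "1 \<le> N * G i x" using N by simp
      qed
      then have "emeasure riesz_measure (A i) \<le> ennreal (N * L (G i))"
        by (simp add: emeasure_riesz_measure scale Gc)
      moreover have "0 \<le> L (G i)" by (intro nonneg Gc) (simp add: G_def)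
      ultimately show ?thesis by (simp add: emeasure_eq_measure)
    qed
    have "g x \<le> 1 / N + (\<Sum>i<N. (1 / N) * indicator (A i) x)" for x
    proof -
      have "real N / N = 1" "1 / real N > 0" using N by auto
      then have "g x - 1 / N \<le> real N / N" using g(3)[of x] order_trans[of "g x - 1 / N" "g x" 1] by simp
      then have "min (real N / N) (g x - 1 / N) = g x - 1 / N" by (rule min_absorb2)
      with low[of N x] show ?thesis by simp
    qed
    then have "(\<integral>x. g x \<partial>riesz_measure) \<le> (\<integral>x. 1 / N + (\<Sum>i<N. (1 / N) * indicator (A i) x) \<partial>riesz_measure)"
      by (intro integral_mono gi) (auto simp: emeasure_eq_measure)
    also have "\<dots> = 1 / N + (\<Sum>i<N. (1 / N) * measure riesz_measure (A i))"
      by (subst Bochner_Integration.integral_add) (use prob_space in \<open>auto simp: emeasure_eq_measure\<close>)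
    also have "\<dots> \<le> 1 / N + (\<Sum>i<N. L (G i))"
      using mA N by (intro add_left_mono sum_mono) (simp add: field_simps)
    also have "(\<Sum>i<N. L (G i)) = L (\<lambda>x. \<Sum>i<N. G i x)" by (rule sum[symmetric]) (rule Gc)
    also have "(\<lambda>x. \<Sum>i<N. G i x) = g" using up[of _ N] N g(3) by (simp add: min_absorb2)
    finally show ?thesis by simp
  qed
  show ?thesis
  proof (rule field_le_epsilon)
    fix e :: real assume "0 < e"
    then obtain N :: nat where "N > 0" "1 / real N < e"
      using ex_inverse_of_nat_less[of e] by (auto simp: inverse_eq_divide)
    with main[of N] show "(\<integral>x. g x \<partial>riesz_measure) \<le> L g + e" by simp
  qed
qed

lemma integral_riesz_measure_le:
  assumes g: "continuous_on UNIV g" "\<And>x. \<bar>g x\<bar> \<le> B"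
  shows "(\<integral>x. g x \<partial>riesz_measure) \<le> L g"
proof -
  interpret prob_space riesz_measure by (rule prob_space_riesz_measure)
  define b where "b = B + 1"
  have b: "b > 0" using g(2)[of undefined] by (simp add: b_def)
  have gm [measurable]: "g \<in> borel_measurable borel" using g(1) by (rule borel_measurable_continuous_onI)
  have gi: "integrable riesz_measure g"
    by (rule integrable_const_bound[of _ B]) (use g in auto)
  have *: "0 \<le> b + g x" "g x \<le> b" for x using g(2)[of x] by (auto simp: b_def)
  have c: "continuous_on UNIV (\<lambda>x. 1/(2*b) * g x)" by (intro continuous_intros g)
  have "(\<integral>x. 1/(2*b) * g x + 1/2 \<partial>riesz_measure) \<le> L (\<lambda>x. 1/(2*b) * g x + 1/2)"
    by (rule integral_riesz_measure_le_unit)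
       (use *  b in \<open>auto intro!: continuous_intros g simp: field_simps\<close>)
  also have "\<dots> = 1/(2*b) * L g + 1/2"
    using add[OF c, of "\<lambda>_. 1/2"] scale[OF g(1), of "1/(2*b)"] const[of "1/2"]
    by (simp only: continuous_on_const)
  also have "(\<integral>x. 1/(2*b) * g x + 1/2 \<partial>riesz_measure) = 1/(2*b) * (\<integral>x. g x \<partial>riesz_measure) + 1/2"
    using gi prob_space by simp
  finally show ?thesis using b by (simp add: field_simps)
qed

text \<open>
Composing a cover with \<open>T\<close> does not change its cost, so preimages are not larger than the set
itself.  Since the total mass is finite, passing to complements gives equality.
\<close>
lemma distr_riesz_measure:
  assumes T: "continuous_on UNIV T" "T ` S \<subseteq> S"
    and inv: "\<And>g. continuous_on UNIV g \<Longrightarrow> L (\<lambda>x. g (T x)) = L g"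
  shows "distr riesz_measure borel T = riesz_measure"
proof -
  interpret prob_space riesz_measure by (rule prob_space_riesz_measure)
  have Tm [measurable]: "T \<in> borel_measurable borel" using T(1) by (rule borel_measurable_continuous_onI)
  have le: "outer (T -` A) \<le> outer A" for A
    unfolding outer_def[of A]
  proof (rule INF_greatest, clarsimp)
    fix g assume g: "admissible g A"
    have "admissible (\<lambda>n x. g n (T x)) (T -` A)"
      using g T unfolding admissible_def
      by (auto intro!: continuous_on_compose2[where g="g _" and f=T and s=UNIV and t=UNIV])
    then have "outer (T -` A) \<le> (\<Sum>n. ennreal (L (\<lambda>x. g n (T x))))" by (rule outer_le)
    also have "\<dots> = (\<Sum>n. ennreal (L (g n)))" using g by (simp add: inv admissible_def)
    finally show "outer (T -` A) \<le> (\<Sum>n. ennreal (L (g n)))" .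
  qed
  have Tb: "T -` A \<in> sets borel" if "A \<in> sets borel" for A
    using measurable_sets[OF Tm that] by simp
  have le': "prob (T -` A) \<le> prob A" if "A \<in> sets borel" for A
    using le[of A] that Tb[OF that] by (simp add: emeasure_eq_measure flip: emeasure_riesz_measure)
  show ?thesis
  proof (rule measure_eqI)
    fix A assume "A \<in> sets (distr riesz_measure borel T)"
    then have A: "A \<in> sets borel" by simp
    have "prob (T -` (UNIV - A)) \<le> prob (UNIV - A)" using A by (intro le') auto
    moreover have "T -` (UNIV - A) = UNIV - T -` A" by auto
    ultimately have "prob A \<le> prob (T -` A)"
      using prob_compl[of A] prob_compl[of "T -` A"] A Tb[OF A] by simp
    with le'[OF A] show "emeasure (distr riesz_measure borel T) A = emeasure riesz_measure A"
      using A by (simp add: emeasure_distr emeasure_eq_measure)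
  qed simp
qed

end

section \<open>Invariant measures from orbit segments\<close>

text \<open>
By Tychonoff's theorem the points \<open>X k\<close> accumulate in a product of compact intervals, so one
filter serves all coordinates at once, however many there are.  Below the coordinates are the
test functions and the limit is the analogue of a weak limit of measures.
\<close>
lemma simultaneous_cluster_point:
  fixes X :: "nat \<Rightarrow> 'b \<Rightarrow> real"
  assumes "\<And>i. \<exists>B. \<forall>k. \<bar>X k i\<bar> \<le> B"
  shows "\<exists>F L. F \<noteq> bot \<and> F \<le> sequentially \<and> (\<forall>i. ((\<lambda>k. X k i) \<longlongrightarrow> L i) F)"
proof -
  obtain B where B: "\<And>i k. \<bar>X k i\<bar> \<le> B i" using assms by metis
  define U where "U = (\<Pi>\<^sub>E i\<in>UNIV. {- B i..B i})"
  have "compactin (product_topology (\<lambda>_. euclidean) UNIV) U"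
    unfolding U_def compactin_PiE by auto
  then have "compact U" by (simp add: euclidean_product_topology)
  moreover have "eventually (\<lambda>x. x \<in> U) (filtermap X sequentially)"
    unfolding eventually_filtermap U_def using B
    by (auto simp: PiE_UNIV_domain abs_le_iff minus_le_iff intro!: always_eventually)
  moreover have "filtermap X sequentially \<noteq> bot" by (simp add: filtermap_bot_iff)
  ultimately obtain L where L: "inf (nhds L) (filtermap X sequentially) \<noteq> bot"
    unfolding compact_filter by blast
  define F where "F = inf sequentially (filtercomap X (nhds L))"
  have "F \<noteq> bot"
  proof
    assume "F = bot"
    then have "eventually (\<lambda>_. False) F" by simp
    then obtain P Q where PQ: "eventually P sequentially" "eventually Q (nhds L)"
       "\<And>k. P k \<Longrightarrow> Q (X k) \<Longrightarrow> False"
      unfolding F_def eventually_inf eventually_filtercomap by metis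
    have "eventually (\<lambda>x. \<not> Q x) (filtermap X sequentially)"
      unfolding eventually_filtermap using PQ(1) by (rule eventually_mono) (use PQ in auto)
    then have "eventually (\<lambda>_. False) (inf (nhds L) (filtermap X sequentially))"
      using PQ(2) unfolding eventually_inf by blast
    with L show False by (simp add: trivial_limit_def)
  qed
  moreover have "F \<le> sequentially" by (simp add: F_def)
  moreover have "((\<lambda>k. X k i) \<longlongrightarrow> L i) F" for i
  proof -
    have "filterlim X (nhds L) F"
      unfolding filterlim_def F_def
      by (meson filterlim_def filterlim_filtercomap filtermap_mono inf_le2 order_trans)
    moreover have "((\<lambda>M. M i) \<longlongrightarrow> L i) (nhds L)"
    proof -
      have "continuous_on UNIV (\<lambda>M :: 'b \<Rightarrow> real. M i)"
        by (rule continuous_on_product_coordinates)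
      then have "((\<lambda>M. M i) \<longlongrightarrow> L i) (at L)" by (simp add: continuous_on_def)
      then show ?thesis by (subst (asm) tendsto_at_iff_tendsto_nhds)
    qed
    ultimately show ?thesis by (rule filterlim_compose[rotated])
  qed
  ultimately show ?thesis by blast
qed

text \<open>
Empirical averages along longer and longer orbit segments accumulate at a positive functional.
It is invariant because replacing \<open>g\<close> by \<open>g \<circ> T\<close> changes an average over \<open>n\<close> points only in its
two end terms, hence by \<open>O(1/n)\<close>.  A bound on the averages of \<open>\<Phi>\<close> passes to the limit.
\<close>
lemma krylov_bogolyubov:
  fixes T :: "'a::metric_space \<Rightarrow> 'a" and \<Phi> :: "'a \<Rightarrow> real"
  assumes S: "compact S" and T: "continuous_on UNIV T" "T ` S \<subseteq> S"
    and \<Phi>: "continuous_on UNIV \<Phi>" "\<And>x. \<bar>\<Phi> x\<bar> \<le> B"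
    and y: "\<And>k. y k \<in> S" and avg: "\<And>k. (\<Sum>i<Suc k. \<Phi> ((T ^^ i) (y k))) \<le> 0"
  shows "\<exists>\<nu>. prob_space \<nu> \<and> sets \<nu> = sets borel \<and> distr \<nu> borel T = \<nu> \<and>
    emeasure \<nu> (- S) = 0 \<and> (\<integral>x. \<Phi> x \<partial>\<nu>) \<le> 0"
proof -
  define X where "X k g = (if continuous_on UNIV g
      then (\<Sum>i<Suc k. g ((T ^^ i) (y k))) / Suc k else 0)" for k and g :: "'a \<Rightarrow> real"
  have orb: "(T ^^ i) x \<in> S" if "x \<in> S" for i x
    using that T(2) by (induction i) auto
  have bdd: "\<exists>b. \<forall>x\<in>S. \<bar>g x\<bar> \<le> b" if "continuous_on UNIV g" for g :: "'a \<Rightarrow> real"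
  proof -
    have "bounded (g ` S)"
      using S that by (meson compact_continuous_image compact_imp_bounded continuous_on_subset top_greatest)
    then show ?thesis by (auto simp: bounded_iff)
  qed
  have "\<exists>b. \<forall>k. \<bar>X k g\<bar> \<le> b" for g
  proof (cases "continuous_on UNIV g")
    case True
    then obtain b where b: "\<And>x. x \<in> S \<Longrightarrow> \<bar>g x\<bar> \<le> b" using bdd by blast
    have "\<bar>X k g\<bar> \<le> b" for k
    proof -
      have "\<bar>\<Sum>i<Suc k. g ((T ^^ i) (y k))\<bar> \<le> (\<Sum>i<Suc k. b)"
        by (intro order_trans[OF sum_abs] sum_mono b orb y)
      then show ?thesis using True by (simp add: X_def abs_divide divide_le_eq mult.commute)
    qed
    then show ?thesis by blast
  qed (auto simp: X_def)
  then obtain F L where F: "F \<noteq> bot" "F \<le> sequentially"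
    and L: "\<And>g. ((\<lambda>k. X k g) \<longlongrightarrow> L g) F"
    using simultaneous_cluster_point[of X] by blast
  interpret L: normalized_positive_functional S L
  proof
    show "compact S" by fact
  next
    fix g h :: "'a \<Rightarrow> real" assume g: "continuous_on UNIV g" and h: "continuous_on UNIV h"
    have "X k (\<lambda>x. g x + h x) = X k g + X k h" for k
      using g h by (simp add: X_def continuous_on_add sum.distrib add_divide_distrib)
    then have "((\<lambda>k. X k (\<lambda>x. g x + h x)) \<longlongrightarrow> L g + L h) F"
      using tendsto_add[OF L[of g] L[of h]] by simp
    then show "L (\<lambda>x. g x + h x) = L g + L h" using tendsto_unique[OF F(1) L] by blast
  next
    fix c and g :: "'a \<Rightarrow> real" assume g: "continuous_on UNIV g"
    have "X k (\<lambda>x. c * g x) = c * X k g" for k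
      using g by (simp add: X_def continuous_on_mult_left sum_distrib_left distrib_left)
    then have "((\<lambda>k. X k (\<lambda>x. c * g x)) \<longlongrightarrow> c * L g) F"
      using tendsto_mult_left[OF L[of g], of c] by simp
    then show "L (\<lambda>x. c * g x) = c * L g" using tendsto_unique[OF F(1) L] by blast
  next
    fix g :: "'a \<Rightarrow> real" assume g: "continuous_on UNIV g" "\<And>x. x \<in> S \<Longrightarrow> 0 \<le> g x"
    then have "0 \<le> X k g" for k by (simp add: X_def sum_nonneg orb y)
    then show "0 \<le> L g" using tendsto_lowerbound[OF L _ F(1), of 0 g] by simp
  next
    have "X k (\<lambda>_. 1) = 1" for k by (simp add: X_def)
    then have "((\<lambda>k. X k (\<lambda>_. 1)) \<longlongrightarrow> 1) F" by simp
    then show "L (\<lambda>_. 1) = 1" using tendsto_unique[OF F(1) L] by blast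
  qed
  have inv: "L (\<lambda>x. g (T x)) = L g" if g: "continuous_on UNIV g" for g
  proof -
    obtain b where b: "\<And>x. x \<in> S \<Longrightarrow> \<bar>g x\<bar> \<le> b" using bdd g by blast
    have gT: "continuous_on UNIV (\<lambda>x. g (T x))"
      using g T(1) by (rule continuous_on_compose2) auto
    have eq: "X k (\<lambda>x. g (T x)) - X k g = (g ((T ^^ Suc k) (y k)) - g (y k)) / Suc k" for k
    proof -
      have "(\<Sum>i<Suc k. g (T ((T ^^ i) (y k)))) - (\<Sum>i<Suc k. g ((T ^^ i) (y k)))
          = (\<Sum>i<Suc k. g ((T ^^ Suc i) (y k)) - g ((T ^^ i) (y k)))"
        by (simp add: sum_subtractf)
      also have "\<dots> = g ((T ^^ Suc k) (y k)) - g ((T ^^ 0) (y k))"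
        by (rule sum_lessThan_telescope)
      finally show ?thesis using g gT by (simp only: X_def if_True diff_divide_distrib[symmetric]) simp
    qed
    have "(\<lambda>k. X k (\<lambda>x. g (T x)) - X k g) \<longlonglongrightarrow> 0"
    proof (rule Lim_null_comparison)
      have "norm (X k (\<lambda>x. g (T x)) - X k g) \<le> 2 * b / Suc k" for k
        unfolding eq using b[OF orb[OF y[of k]], of "Suc k"] b[OF y[of k]]
        by (simp add: abs_divide divide_right_mono abs_le_iff del: funpow.simps)
      then show "\<forall>\<^sub>F k in sequentially. norm (X k (\<lambda>x. g (T x)) - X k g) \<le> 2 * b / Suc k"
        by simp
      show "(\<lambda>k. 2 * b / Suc k) \<longlonglongrightarrow> 0"
        by (rule LIMSEQ_Suc[of "\<lambda>k. 2 * b / real k"]) (rule lim_const_over_n)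
    qed
    then have "((\<lambda>k. X k (\<lambda>x. g (T x)) - X k g) \<longlongrightarrow> 0) F"
      by (rule tendsto_mono[OF F(2)])
    moreover have "((\<lambda>k. X k (\<lambda>x. g (T x)) - X k g) \<longlongrightarrow> L (\<lambda>x. g (T x)) - L g) F"
      by (intro tendsto_diff L)
    ultimately have "L (\<lambda>x. g (T x)) - L g = 0" using tendsto_unique[OF F(1)] by blast
    then show ?thesis by simp
  qed
  have "X k \<Phi> \<le> 0" for k using avg[of k] \<Phi>(1) by (simp add: X_def divide_le_0_iff)
  then have "L \<Phi> \<le> 0" using tendsto_upperbound[OF L _ F(1), of \<Phi> 0] by simp
  then have "(\<integral>x. \<Phi> x \<partial>L.riesz_measure) \<le> 0" using L.integral_riesz_measure_le[OF \<Phi>] by simp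
  then show ?thesis
    using L.prob_space_riesz_measure L.sets_riesz_measure L.distr_riesz_measure[OF T inv] L.riesz_measure_null by blast
qed

section \<open>The maximal ergodic theorem\<close>

text \<open>
Garsia's argument: for the maximum \<open>M n\<close> of the first \<open>n + 1\<close> partial sums (starting with the
empty sum \<open>0\<close>) one has \<open>M n - M n \<circ> T \<le> g\<close> where \<open>M n > 0\<close>, and \<open>M n - M n \<circ> T \<le> 0\<close> elsewhere,
while the integral of \<open>M n - M n \<circ> T\<close> vanishes by invariance.
\<close>
lemma maximal_ergodic:
  fixes T :: "'a \<Rightarrow> 'a" and g :: "'a \<Rightarrow> real"
  assumes "prob_space \<nu>" and T [measurable]: "T \<in> measurable \<nu> \<nu>" and inv: "distr \<nu> \<nu> T = \<nu>"
    and g [measurable]: "g \<in> borel_measurable \<nu>" and B: "\<And>x. \<bar>g x\<bar> \<le> B"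
    and pos: "AE x in \<nu>. \<exists>n. 0 < (\<Sum>i<n. g ((T ^^ i) x))"
  shows "0 \<le> (\<integral>x. g x \<partial>\<nu>)"
proof -
  interpret prob_space \<nu> by fact
  \<comment> \<open>The recursion computes the maximum of the partial sums, since the sum over \<open>n + 1\<close> terms
     at \<open>x\<close> is \<open>g x\<close> plus the sum over \<open>n\<close> terms at \<open>T x\<close>.\<close>
  define M where "M = rec_nat (\<lambda>x. 0 :: real) (\<lambda>_ m x. max 0 (g x + m (T x)))"
  have M0: "M 0 x = 0" and MS: "M (Suc n) x = max 0 (g x + M n (T x))" for n x
    by (simp_all add: M_def)
  have Mm [measurable]: "M n \<in> borel_measurable \<nu>" for n
    by (induction n) (simp_all add: M0[abs_def] MS[abs_def])
  have nn: "0 \<le> M n x" for n x by (cases n) (auto simp: M0 MS)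
  have mono: "M n x \<le> M (Suc n) x" for n x
  proof (induction n arbitrary: x)
    case (Suc n)
    show ?case unfolding MS[of n x] MS[of "Suc n" x] using Suc[of "T x"] by (intro max.mono) auto
  qed (simp add: M0 nn)
  have B0: "B \<ge> 0" using B[of undefined] by linarith
  have ub: "M n x \<le> n * B" for n x
  proof (induction n arbitrary: x)
    case (Suc n) 
    have "g x + M n (T x) \<le> B + n * B" using Suc[of "T x"] B[of x] by linarith
    then show ?case using B0 by (simp add: MS algebra_simps)
  qed (simp add: M0)
  have sum_le: "(\<Sum>i<n. g ((T ^^ i) x)) \<le> M n x" for n x
  proof (induction n arbitrary: x)
    case (Suc n)
    have "(\<Sum>i<Suc n. g ((T ^^ i) x)) = g x + (\<Sum>i<n. g ((T ^^ i) (T x)))"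
      by (simp only: sum.lessThan_Suc_shift funpow_Suc_right o_apply) simp
    then show ?case using Suc[of "T x"] by (simp add: MS)
  qed (simp add: M0)
  have inc: "M n x \<le> M m x" if "n \<le> m" for n m x
    by (rule lift_Suc_mono_le[of "\<lambda>n. M n x", OF mono that])
  define P where "P n = {x \<in> space \<nu>. 0 < M n x}" for n
  have Pm [measurable]: "P n \<in> sets \<nu>" for n unfolding P_def by measurable
  have Mi: "integrable \<nu> (M n)" for n
    by (rule integrable_const_bound[of _ "n * B"]) (use nn ub in auto)
  have MTi: "integrable \<nu> (\<lambda>x. M n (T x))" for n
    by (rule integrable_const_bound[of _ "n * B"]) (use nn ub in auto)
  have gi: "integrable \<nu> (\<lambda>x. g x * indicator (P n) x)" for n
    by (rule integrable_const_bound[of _ B]) (use B B0 in \<open>auto simp: indicator_def\<close>)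
  have part: "0 \<le> (\<integral>x. g x * indicator (P n) x \<partial>\<nu>)" for n
  proof -
    have "(\<integral>x. M n (T x) \<partial>\<nu>) = (\<integral>x. M n x \<partial>distr \<nu> \<nu> T)"
      by (rule integral_distr[symmetric]) measurable
    then have "0 = (\<integral>x. M n x - M n (T x) \<partial>\<nu>)"
      using Mi MTi by (simp add: inv)
    also have "\<dots> \<le> (\<integral>x. g x * indicator (P n) x \<partial>\<nu>)"
    proof (rule integral_mono)
      fix x assume x: "x \<in> space \<nu>"
      show "M n x - M n (T x) \<le> g x * indicator (P n) x"
      proof (cases "0 < M n x")
        case True
        then obtain m where m: "n = Suc m" by (cases n) (auto simp: M0)
        have "M n x = g x + M m (T x)" using True by (auto simp: m MS)
        then show ?thesis using True x mono[of m "T x"] by (simp add: m P_def)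
      next
        case False
        then show ?thesis using nn[of n x] nn[of n "T x"] by (simp add: P_def)
      qed
    qed (use Mi MTi gi in auto)
    finally show ?thesis .
  qed
  have "(\<lambda>n. \<integral>x. g x * indicator (P n) x \<partial>\<nu>) \<longlonglongrightarrow> (\<integral>x. g x \<partial>\<nu>)"
  proof (rule integral_dominated_convergence[where w = "\<lambda>_. B"])
    show "AE x in \<nu>. (\<lambda>n. g x * indicator (P n) x) \<longlonglongrightarrow> g x"
      using pos AE_space
    proof eventually_elim
      case (elim x)
      then obtain n where n: "0 < (\<Sum>i<n. g ((T ^^ i) x))" by blast
      have "x \<in> P m" if "m \<ge> n" for m
        using n sum_le[of x n] inc[OF that, of x] elim by (auto simp: P_def)
      then have "eventually (\<lambda>m. g x * indicator (P m) x = g x) sequentially"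
        by (auto intro!: eventually_sequentiallyI[of n])
      then show ?case by (rule tendsto_eventually)
    qed
    show "AE x in \<nu>. norm (g x * indicator (P n) x) \<le> B" for n
      using B B0 by (auto simp: indicator_def)
  qed auto
  then show ?thesis by (rule LIMSEQ_le_const) (use part in auto)
qed

text \<open>
The maximal ergodic theorem for \<open>\<Phi>\<close> itself would only give a nonnegative integral.  Strictness
comes from applying it to \<open>\<Phi> - \<psi> / 2\<close>, where \<open>\<psi>\<close> is the upper average truncated at \<open>1\<close>: as \<open>\<psi>\<close> is
invariant, subtracting \<open>\<psi> / 2\<close> just shifts the averages along an orbit by a constant and
leaves their upper limit positive.
\<close>
lemma integral_pos_of_limsup_average_pos:
  fixes T :: "'a \<Rightarrow> 'a" and \<Phi> :: "'a \<Rightarrow> real"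
  assumes "prob_space \<nu>" and T [measurable]: "T \<in> measurable \<nu> \<nu>" and inv: "distr \<nu> \<nu> T = \<nu>"
    and \<Phi> [measurable]: "\<Phi> \<in> borel_measurable \<nu>" and B: "\<And>x. \<bar>\<Phi> x\<bar> \<le> B"
    and pos: "AE x in \<nu>. 0 < limsup (\<lambda>n. ereal ((\<Sum>i<n. \<Phi> ((T ^^ i) x)) / n))"
  shows "0 < (\<integral>x. \<Phi> x \<partial>\<nu>)"
proof -
  interpret prob_space \<nu> by fact
  have B0: "B \<ge> 0" using B[of undefined] by linarith
  have Tn [measurable]: "(\<lambda>x. (T ^^ n) x) \<in> measurable \<nu> \<nu>" for n
    by (induction n) (simp_all add: measurable_compose[OF _ T])
  define A where "A n x = (\<Sum>i<n. \<Phi> ((T ^^ i) x)) / real n" for n x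
  define u where "u x = limsup (\<lambda>n. ereal (A n x))" for x
  define \<psi> where "\<psi> x = real_of_ereal (min 1 (u x))" for x
  have [measurable]: "A n \<in> borel_measurable \<nu>" for n unfolding A_def by measurable
  have [measurable]: "u \<in> borel_measurable \<nu>" unfolding u_def by measurable
  have \<psi>m [measurable]: "\<psi> \<in> borel_measurable \<nu>" unfolding \<psi>_def by measurable
  have Ab: "\<bar>A n x\<bar> \<le> B" for n x
  proof -
    have "\<bar>\<Sum>i<n. \<Phi> ((T ^^ i) x)\<bar> \<le> (\<Sum>i<n. B)"
      by (intro order_trans[OF sum_abs] sum_mono B)
    then show ?thesis using B0 by (cases "n = 0") (auto simp: A_def abs_divide divide_le_eq mult.commute)
  qed
  have uB: "- ereal B \<le> u x" "u x \<le> ereal B" for x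
  proof -
    have "A n x \<le> B" "- B \<le> A n x" for n using Ab[of n x] by auto
    then show "- ereal B \<le> u x" "u x \<le> ereal B"
      unfolding u_def by (auto intro!: le_Limsup Limsup_bounded always_eventually)
  qed
  have eq\<psi>: "ereal (\<psi> x) = min 1 (u x)" for x
    using uB[of x] unfolding \<psi>_def by (intro ereal_real') (cases "u x"; auto simp: min_def)
  have \<psi>1: "\<psi> x \<le> 1" for x using eq\<psi>[of x] by (metis ereal_less_eq(3) min.cobounded1 one_ereal_def)
  have \<psi>B: "- B - 1 \<le> \<psi> x" for x
  proof -
    have "ereal (- B - 1) \<le> min 1 (u x)"
      using uB(1)[of x] B0 by (cases "u x") (auto simp: one_ereal_def)
    then show ?thesis unfolding eq\<psi>[symmetric] by simp
  qed
  have u_inv: "u (T x) = u x" for x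
  proof -
    have eq: "A n (T x) = (\<Phi> ((T ^^ n) x) - \<Phi> x) / n + A n x" for n
    proof -
      have "(\<Sum>i<n. \<Phi> ((T ^^ i) (T x))) - (\<Sum>i<n. \<Phi> ((T ^^ i) x))
          = (\<Sum>i<n. \<Phi> ((T ^^ Suc i) x) - \<Phi> ((T ^^ i) x))"
        by (simp add: sum_subtractf funpow_swap1)
      also have "\<dots> = \<Phi> ((T ^^ n) x) - \<Phi> ((T ^^ 0) x)"
        by (rule sum_lessThan_telescope)
      finally have "(\<Sum>i<n. \<Phi> ((T ^^ i) (T x))) = (\<Phi> ((T ^^ n) x) - \<Phi> x) + (\<Sum>i<n. \<Phi> ((T ^^ i) x))"
        by simp
      then show ?thesis unfolding A_def add_divide_distrib[symmetric] by (rule arg_cong)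
    qed
    have "(\<lambda>n. (\<Phi> ((T ^^ n) x) - \<Phi> x) / n) \<longlonglongrightarrow> 0"
    proof (rule Lim_null_comparison[OF _ lim_const_over_n[of "2 * B"]])
      have "norm ((\<Phi> ((T ^^ n) x) - \<Phi> x) / n) \<le> 2 * B / n" for n
        using B[of "(T ^^ n) x"] B[of x] by (auto simp: abs_divide intro!: divide_right_mono)
      then show "\<forall>\<^sub>F n in sequentially. norm ((\<Phi> ((T ^^ n) x) - \<Phi> x) / n) \<le> 2 * B / n" by simp
    qed
    then have "(\<lambda>n. ereal ((\<Phi> ((T ^^ n) x) - \<Phi> x) / n)) \<longlonglongrightarrow> ereal 0" by simp
    from ereal_limsup_lim_add[OF this, of "\<lambda>n. ereal (A n x)"]
    show ?thesis by (simp add: u_def eq)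
  qed
  have \<psi>_inv: "\<psi> ((T ^^ i) x) = \<psi> x" for i x
    by (induction i) (auto simp: \<psi>_def u_inv)
  define g where "g x = \<Phi> x - \<psi> x / 2" for x
  have [measurable]: "g \<in> borel_measurable \<nu>" unfolding g_def by measurable
  have \<Phi>i: "integrable \<nu> \<Phi>" by (rule integrable_const_bound[of _ B]) (use B in auto)
  have \<psi>i: "integrable \<nu> \<psi>"
  proof (rule integrable_const_bound[of _ "B + 1"])
    have "norm (\<psi> x) \<le> B + 1" for x using \<psi>1[of x] \<psi>B[of x] B0 by auto
    then show "AE x in \<nu>. norm (\<psi> x) \<le> B + 1" by simp
  qed simp
  have \<psi>pos: "AE x in \<nu>. 0 < \<psi> x"
    using pos
  proof eventually_elim
    case (elim x)
    then have "0 < u x" unfolding u_def A_def .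
    then have "ereal 0 < ereal (\<psi> x)" unfolding eq\<psi> by (simp add: min_def flip: zero_ereal_def)
    then show ?case by simp
  qed
  have "0 \<le> (\<integral>x. g x \<partial>\<nu>)"
  proof (rule maximal_ergodic[OF \<open>prob_space \<nu>\<close> T inv])
    show "\<bar>g x\<bar> \<le> 2 * B + 1" for x
      unfolding g_def using B[of x] \<psi>1[of x] \<psi>B[of x] B0 by (auto simp: abs_le_iff)
    show "AE x in \<nu>. \<exists>n. 0 < (\<Sum>i<n. g ((T ^^ i) x))"
      using \<psi>pos
    proof eventually_elim
      case (elim x)
      show ?case
      proof (rule ccontr)
        assume neg: "\<not> (\<exists>n. 0 < (\<Sum>i<n. g ((T ^^ i) x)))"
        have "A n x \<le> \<psi> x / 2" if "n > 0" for n
        proof -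
          have "(\<Sum>i<n. g ((T ^^ i) x)) = (\<Sum>i<n. \<Phi> ((T ^^ i) x)) - n * (\<psi> x / 2)"
            by (simp add: g_def \<psi>_inv sum_subtractf)
          moreover have "(\<Sum>i<n. g ((T ^^ i) x)) \<le> 0" using neg by (meson not_le)
          ultimately show ?thesis using that by (simp add: A_def field_simps)
        qed
        then have "u x \<le> ereal (\<psi> x / 2)" unfolding u_def
          by (intro Limsup_bounded) (auto intro!: eventually_sequentiallyI[of 1])
        moreover have "ereal (\<psi> x) \<le> u x" by (simp add: eq\<psi>)
        ultimately have "\<psi> x \<le> \<psi> x / 2" by (metis ereal_less_eq(3) order_trans)
        then show False using elim by simp
      qed
    qed
  qed measurable
  moreover have "(\<integral>x. g x \<partial>\<nu>) = (\<integral>x. \<Phi> x \<partial>\<nu>) - (\<integral>x. \<psi> x \<partial>\<nu>) / 2"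
    unfolding g_def using \<Phi>i \<psi>i by simp
  moreover have "(\<integral>x. 0 \<partial>\<nu>) < (\<integral>x. \<psi> x \<partial>\<nu>)"
    by (rule integral_less_AE_space) (use \<psi>i \<psi>pos in \<open>auto simp: emeasure_space_1\<close>)
  ultimately show ?thesis by simp
qed

section \<open>Holomorphic maps in two complex variables\<close>

text \<open>
The derivative is given by a complex matrix, so these are the holomorphic maps.
\<close>
definition C1 :: "(complex^2 \<Rightarrow> complex^2) \<Rightarrow> bool" where
  "C1 f \<longleftrightarrow> (\<exists>A :: complex^2 \<Rightarrow> complex^2^2. continuous_on UNIV A \<and>
    (\<forall>x. (f has_derivative (*v) (A x)) (at x)))"

lemma matrix_vector_mult_2: "A *v v = vector [A$1$1 * v$1 + A$1$2 * v$2, A$2$1 * v$1 + A$2$2 * v$2]"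
  for A :: "complex^2^2"
  by (simp add: vec_eq_iff forall_2 matrix_vector_mult_def sum_2)

lemma continuous_on_vector_2:
  fixes g h :: "'a::topological_space \<Rightarrow> 'b::{topological_space,zero}"
  assumes "continuous_on S g" "continuous_on S h"
  shows "continuous_on S (\<lambda>x. vector [g x, h x] :: 'b^2)"
proof -
  have "continuous_on S (\<lambda>x. (\<chi> i::2. if i = 1 then g x else h x) :: 'b^2)"
  proof (rule continuous_on_vec_lambda)
    show "continuous_on S (\<lambda>x. if i = 1 then g x else h x)" for i :: 2
      using assms by (cases "i = 1") auto
  qed
  moreover have "(\<chi> i::2. if i = 1 then g x else h x) = (vector [g x, h x] :: 'b^2)" for x
    by (simp add: vec_eq_iff forall_2)
  ultimately show ?thesis by simp
qed

lemma continuous_on_matrix_vector_mult: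
  fixes A :: "'a::topological_space \<Rightarrow> complex^2^2"
  assumes "continuous_on S A" "continuous_on S v"
  shows "continuous_on S (\<lambda>x. A x *v v x)"
  unfolding matrix_vector_mult_2 by (intro continuous_on_vector_2 continuous_intros assms)

lemma continuous_on_matrix_mult:
  fixes A B :: "'a::topological_space \<Rightarrow> complex^2^2"
  assumes "continuous_on S A" "continuous_on S B"
  shows "continuous_on S (\<lambda>x. A x ** B x)"
  unfolding matrix_matrix_mult_def by (intro continuous_intros assms)

lemma C1_compose:
  assumes "C1 f" "C1 g" shows "C1 (f \<circ> g)"
proof -
  obtain A where A: "continuous_on UNIV A" "\<And>x. (f has_derivative (*v) (A x)) (at x)"
    using assms(1) by (auto simp: C1_def)
  obtain B where B: "continuous_on UNIV B" "\<And>x. (g has_derivative (*v) (B x)) (at x)"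
    using assms(2) by (auto simp: C1_def)
  have "continuous_on UNIV g"
    by (meson B(2) continuous_at_imp_continuous_on has_derivative_continuous)
  then have "continuous_on UNIV (\<lambda>x. A (g x) ** B x)"
    by (intro continuous_on_matrix_mult B continuous_on_compose2[OF A(1)]) auto
  moreover have "(f \<circ> g has_derivative (*v) (A (g x) ** B x)) (at x)" for x
    using diff_chain_at[OF B(2) A(2)[of "g x"]] by (simp add: o_def matrix_vector_mul_assoc)
  ultimately show ?thesis unfolding C1_def
    by (intro exI[of _ "\<lambda>x. A (g x) ** B x"]) auto
qed

lemma C1_id: "C1 id"
proof -
  have "(*v) (mat 1 :: complex^2^2) = (\<lambda>x. x)" by (simp add: fun_eq_iff)
  then show ?thesis unfolding C1_def by (intro exI[of _ "\<lambda>_. mat 1"]) (auto simp: id_def)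
qed

lemma C1_funpow: "C1 f \<Longrightarrow> C1 (f ^^ n)"
  by (induction n) (auto simp: C1_id[unfolded id_def] C1_id intro: C1_compose)

lemma
  assumes "C1 f"
  shows C1_has_derivative: "(f has_derivative Df f x) (at x)"
    and C1_Df: "Df f x = (*v) (matrix (Df f x))"
    and C1_continuous_Df: "continuous_on UNIV (\<lambda>x. matrix (Df f x))"
    and C1_continuous: "continuous_on UNIV f"
proof -
  obtain A where A: "continuous_on UNIV A" "\<And>x. (f has_derivative (*v) (A x)) (at x)"
    using assms by (auto simp: C1_def)
  have D: "Df f x = (*v) (A x)" for x using frechet_derivative_at[OF A(2)] by simp
  have M: "matrix (Df f x) = A x" for x unfolding D by simp
  show "(f has_derivative Df f x) (at x)" using A(2) D by simp
  show "Df f x = (*v) (matrix (Df f x))" unfolding M by (rule D)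
  show "continuous_on UNIV (\<lambda>x. matrix (Df f x))" unfolding M by (rule A(1))
  show "continuous_on UNIV f"
    by (meson A(2) continuous_at_imp_continuous_on has_derivative_continuous)
qed

lemma Df_compose:
  assumes "C1 f" "C1 g" shows "Df (f \<circ> g) x = Df f (g x) \<circ> Df g x"
  using frechet_derivative_at[OF diff_chain_at[OF C1_has_derivative[OF assms(2)] C1_has_derivative[OF assms(1)]]]
  by simp

lemma Df_id: "Df id x = id"
  using frechet_derivative_at[OF has_derivative_id[of "at x"]] by (simp add: id_def)

lemma Df_add: "C1 f \<Longrightarrow> Df f x (u + v) = Df f x u + Df f x v"
  by (subst (1 2 3) C1_Df) (auto simp: matrix_vector_right_distrib)

lemma Df_scale: "C1 f \<Longrightarrow> Df f x (c *s v) = c *s Df f x v"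
  by (subst (1 2) C1_Df) (auto simp: matrix_vector_mult_scaleR vector_scalar_commute)

section \<open>Henon maps and the cones at infinity\<close>

lemma has_derivative_vec2:
  fixes f :: "complex^2 \<Rightarrow> complex^2"
  assumes "\<And>i. ((\<lambda>x. f x $ i) has_derivative (\<lambda>v. f' v $ i)) (at a)"
  shows "(f has_derivative f') (at a)"
  unfolding has_derivative_componentwise_within[of f f' a UNIV]
  by (auto simp: Basis_vec_def inner_axis intro!: has_derivative_inner_left assms)

definition henon_inverse :: "complex poly \<Rightarrow> complex \<Rightarrow> complex^2 \<Rightarrow> complex^2" where
  "henon_inverse p b w = vector [(poly p (w $ 1) - w $ 2) / b, w $ 1]"

lemma henon_factor_inverse:
  assumes "b \<noteq> 0"
  shows "henon_inverse p b (henon_factor p b v) = v" "henon_factor p b (henon_inverse p b v) = v"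
  using assms by (auto simp: henon_inverse_def henon_factor_def vec_eq_iff forall_2)

lemma bij_henon_factor: "b \<noteq> 0 \<Longrightarrow> bij (henon_factor p b)"
  by (rule bijI[OF inj_on_inverseI[of _ "henon_inverse p b"] surjI[of _ "henon_inverse p b"]])
     (auto simp: henon_factor_inverse)

lemma inv_henon_factor: "b \<noteq> 0 \<Longrightarrow> inv (henon_factor p b) = henon_inverse p b"
  by (rule inv_equality) (auto simp: henon_factor_inverse)

lemma has_derivative_nth: "((\<lambda>v. v $ i) has_derivative (\<lambda>v. v $ i)) (at x)"
  by (rule bounded_linear_imp_has_derivative[OF bounded_linear_vec_nth])

lemma has_derivative_poly_nth:
  fixes p :: "complex poly"
  shows "((\<lambda>v::complex^2. poly p (v $ i)) has_derivative (\<lambda>w. poly (pderiv p) (x $ i) * w $ i)) (at x)"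
  by (rule has_derivative_compose[OF has_derivative_nth poly_DERIV[unfolded has_field_derivative_def]])

lemma C1_henon_factor: "C1 (henon_factor p b)"
proof -
  define A :: "complex^2 \<Rightarrow> complex^2^2" where
    "A v = vector [vector [0, 1], vector [- b, poly (pderiv p) (v $ 2)]]" for v
  have "continuous_on UNIV A" unfolding A_def
    by (intro continuous_on_vector_2 continuous_intros)
  moreover have "(henon_factor p b has_derivative (*v) (A x)) (at x)" for x
  proof (rule has_derivative_vec2)
    have "((\<lambda>v. poly p (v $ 2) - b * v $ 1) has_derivative
        (\<lambda>w. poly (pderiv p) (x $ 2) * w $ 2 - b * w $ 1)) (at x)"
      by (intro has_derivative_diff has_derivative_mult_right has_derivative_poly_nth has_derivative_nth)
    moreover have "((\<lambda>v. v $ 2) has_derivative (\<lambda>v. v $ 2)) (at x)" by (rule has_derivative_nth)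
    ultimately show "((\<lambda>v. henon_factor p b v $ i) has_derivative (\<lambda>v. (A x *v v) $ i)) (at x)" for i
      using exhaust_2[of i]
      by (auto simp: henon_factor_def matrix_vector_mult_2 A_def mult.commute)
  qed
  ultimately show ?thesis unfolding C1_def by blast
qed

lemma C1_henon_inverse:
  assumes "b \<noteq> 0" shows "C1 (henon_inverse p b)"
proof -
  define A :: "complex^2 \<Rightarrow> complex^2^2" where
    "A v = vector [vector [poly (pderiv p) (v $ 1) / b, - 1 / b], vector [1, 0]]" for v
  have "continuous_on UNIV A" unfolding A_def
    by (intro continuous_on_vector_2 continuous_intros) (use assms in auto)
  moreover have "(henon_inverse p b has_derivative (*v) (A x)) (at x)" for x
  proof (rule has_derivative_vec2)
    have "((\<lambda>v. (1 / b) * (poly p (v $ 1) - v $ 2)) has_derivative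
        (\<lambda>w. (1 / b) * (poly (pderiv p) (x $ 1) * w $ 1 - w $ 2))) (at x)"
      by (intro has_derivative_diff has_derivative_mult_right has_derivative_poly_nth has_derivative_nth)
    moreover have "((\<lambda>v. v $ 1) has_derivative (\<lambda>v. v $ 1)) (at x)" by (rule has_derivative_nth)
    ultimately show "((\<lambda>v. henon_inverse p b v $ i) has_derivative (\<lambda>v. (A x *v v) $ i)) (at x)" for i
      using exhaust_2[of i] assms
      by (auto simp: henon_inverse_def matrix_vector_mult_2 A_def diff_divide_distrib mult.commute)
  qed
  ultimately show ?thesis unfolding C1_def by blast
qed

text \<open>
With \<open>(i, j) = (2, 1)\<close> these are neighbourhoods of infinity in the vertical direction, expanded
by the map, and with \<open>(i, j) = (1, 2)\<close> in the horizontal direction, expanded by the inverse.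
The factor \<open>2\<close> makes the interiors of the two cones overlap, so that together they cover
everything outside a bidisc.
\<close>
definition cone :: "2 \<Rightarrow> 2 \<Rightarrow> real \<Rightarrow> (complex^2) set" where
  "cone i j R = {v. R \<le> cmod (v $ i) \<and> cmod (v $ j) \<le> 2 * cmod (v $ i)}"

definition doubles_cone :: "2 \<Rightarrow> 2 \<Rightarrow> real \<Rightarrow> (complex^2 \<Rightarrow> complex^2) \<Rightarrow> bool" where
  "doubles_cone i j R f \<longleftrightarrow>
    (\<forall>v\<in>cone i j R. f v \<in> cone i j R \<and> 2 * cmod (v $ i) \<le> cmod (f v $ i))"

lemma doubles_cone_comp:
  assumes "doubles_cone i j R f" "doubles_cone i j R g" shows "doubles_cone i j R (f \<circ> g)"
  unfolding doubles_cone_def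
proof
  fix v assume "v \<in> cone i j R"
  then have g: "g v \<in> cone i j R" "2 * cmod (v $ i) \<le> cmod (g v $ i)"
    using assms(2) by (auto simp: doubles_cone_def)
  then have f: "f (g v) \<in> cone i j R" "2 * cmod (g v $ i) \<le> cmod (f (g v) $ i)"
    using assms(1) by (auto simp: doubles_cone_def)
  have "2 * cmod (v $ i) \<le> cmod (f (g v) $ i)"
    using g(2) f(2) norm_ge_zero[of "g v $ i"] by linarith
  with f show "(f \<circ> g) v \<in> cone i j R \<and> 2 * cmod (v $ i) \<le> cmod ((f \<circ> g) v $ i)" by simp
qed

lemma poly_superlinear:
  fixes p :: "complex poly"
  assumes "degree p \<ge> 2"
  shows "\<exists>r>0. \<forall>z. r \<le> cmod z \<longrightarrow> c * cmod z \<le> cmod (poly p z)"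
proof -
  obtain a q where p: "p = pCons a q" by (cases p)
  obtain a' q' where q: "q = pCons a' q'" by (cases q)
  have "q' \<noteq> 0" using assms by (auto simp: p q split: if_splits)
  from poly_infinity[OF this, of "c + 1" a'] obtain r where
    r: "\<And>z. r \<le> cmod z \<Longrightarrow> c + 1 \<le> cmod (poly q z)" by (auto simp: q)
  show ?thesis
  proof (intro exI[of _ "max 1 (max r (cmod a))"] conjI allI impI)
    fix z assume z: "max 1 (max r (cmod a)) \<le> cmod z"
    have "(c + 1) * cmod z \<le> cmod (poly q z) * cmod z"
      using z by (intro mult_right_mono r) auto
    also have "\<dots> = cmod (z * poly q z)" by (simp add: norm_mult)
    also have "\<dots> \<le> cmod (poly p z) + cmod a"
      using norm_triangle_ineq4[of "poly p z" a] by (simp add: p)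
    finally show "c * cmod z \<le> cmod (poly p z)" using z by (simp add: algebra_simps)
  qed auto
qed

text \<open>
On a cone the polynomial term, being superlinear in the dominant coordinate, outweighs the
linear terms, and the other coordinate of the image is the old dominant one.
\<close>
lemma henon_factor_doubles_cone:
  assumes "degree p \<ge> 2" "b \<noteq> 0"
  shows "\<exists>r>0. \<forall>R\<ge>r. doubles_cone 2 1 R (henon_factor p b) \<and> doubles_cone 1 2 R (henon_inverse p b)"
proof -
  obtain r where r: "r > 0" "\<And>z. r \<le> cmod z \<Longrightarrow> (2 + 2 * cmod b) * cmod z \<le> cmod (poly p z)"
    using poly_superlinear[OF assms(1)] by metis
  have "doubles_cone 2 1 R (henon_factor p b)" if "R \<ge> r" for R
    unfolding doubles_cone_def
  proof
    fix v assume v: "v \<in> cone 2 1 R"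
    have "cmod b * cmod (v $ 1) \<le> cmod b * (2 * cmod (v $ 2))"
      using v by (intro mult_left_mono) (auto simp: cone_def)
    moreover have "(2 + 2 * cmod b) * cmod (v $ 2) \<le> cmod (poly p (v $ 2))"
      using v that by (intro r) (auto simp: cone_def)
    moreover have "cmod (poly p (v $ 2)) \<le> cmod (poly p (v $ 2) - b * v $ 1) + cmod b * cmod (v $ 1)"
      using norm_triangle_ineq[of "poly p (v $ 2) - b * v $ 1" "b * v $ 1"] by (simp add: norm_mult)
    ultimately have "2 * cmod (v $ 2) \<le> cmod (poly p (v $ 2) - b * v $ 1)"
      by (simp add: algebra_simps)
    then show "henon_factor p b v \<in> cone 2 1 R \<and> 2 * cmod (v $ 2) \<le> cmod (henon_factor p b v $ 2)"
      using v r(1) that by (auto simp: cone_def henon_factor_def)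
  qed
  moreover have "doubles_cone 1 2 R (henon_inverse p b)" if "R \<ge> r" for R
    unfolding doubles_cone_def
  proof
    fix v assume v: "v \<in> cone 1 2 R"
    have "(2 + 2 * cmod b) * cmod (v $ 1) \<le> cmod (poly p (v $ 1))"
      using v that by (intro r) (auto simp: cone_def)
    moreover have "cmod (poly p (v $ 1)) \<le> cmod (poly p (v $ 1) - v $ 2) + cmod (v $ 2)"
      using norm_triangle_ineq[of "poly p (v $ 1) - v $ 2" "v $ 2"] by simp
    moreover have "cmod (v $ 2) \<le> 2 * cmod (v $ 1)" using v by (simp add: cone_def)
    ultimately have "2 * cmod (v $ 1) * cmod b \<le> cmod (poly p (v $ 1) - v $ 2)"
      by (simp add: algebra_simps)
    then have "2 * cmod (v $ 1) \<le> cmod ((poly p (v $ 1) - v $ 2) / b)"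
      using assms(2) by (simp add: norm_divide pos_le_divide_eq)
    then show "henon_inverse p b v \<in> cone 1 2 R \<and> 2 * cmod (v $ 1) \<le> cmod (henon_inverse p b v $ 1)"
      using v r(1) that by (auto simp: cone_def henon_inverse_def)
  qed
  ultimately show ?thesis using r(1) by blast
qed

text \<open>
The radius may be enlarged in the last clause, which is what allows composing two maps with
different radii.
\<close>
lemma henon_map_structure:
  assumes "henon_map f"
  shows "bij f \<and> C1 f \<and> C1 (inv f) \<and>
    (\<exists>r>0. \<forall>R\<ge>r. doubles_cone 2 1 R f \<and> doubles_cone 1 2 R (inv f))"
  using assms
proof induction
  case (factor p b)
  then show ?case
    using henon_factor_doubles_cone[of p b]
    by (simp add: bij_henon_factor inv_henon_factor C1_henon_factor C1_henon_inverse)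
next
  case (comp f g)
  have inv: "inv (f \<circ> g) = inv g \<circ> inv f" using comp by (simp add: o_inv_distrib)
  obtain r s where "r > 0" "\<And>R. R \<ge> r \<Longrightarrow> doubles_cone 2 1 R f \<and> doubles_cone 1 2 R (inv f)"
    and "s > 0" "\<And>R. R \<ge> s \<Longrightarrow> doubles_cone 2 1 R g \<and> doubles_cone 1 2 R (inv g)"
    using comp by metis
  then have "\<exists>r>0. \<forall>R\<ge>r. doubles_cone 2 1 R (f \<circ> g) \<and> doubles_cone 1 2 R (inv (f \<circ> g))"
    unfolding inv by (intro exI[of _ "max r s"]) (auto intro: doubles_cone_comp)
  then show ?case using comp by (intro conjI) (auto simp only: inv intro: bij_comp C1_compose)
qed

section \<open>Compactness and invariance of the Julia set\<close>

abbreviation bounded_orbits :: "(complex^2 \<Rightarrow> complex^2) \<Rightarrow> (complex^2) set" where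
  "bounded_orbits f \<equiv> {x. bounded (range (\<lambda>n. (f ^^ n) x))}"

lemma doubles_cone_unbounded:
  assumes "doubles_cone i j R f" "R > 0" "v \<in> cone i j R"
  shows "\<not> bounded (range (\<lambda>n. (f ^^ n) v))"
proof
  have *: "(f ^^ n) v \<in> cone i j R \<and> 2 ^ n * R \<le> cmod ((f ^^ n) v $ i)" for n
  proof (induction n)
    case 0 then show ?case using assms by (auto simp: cone_def)
  next
    case (Suc n) then show ?case using assms(1) by (force simp: doubles_cone_def)
  qed
  assume "bounded (range (\<lambda>n. (f ^^ n) v))"
  then obtain b where b: "\<And>n. norm ((f ^^ n) v) \<le> b" by (auto simp: bounded_iff)
  obtain n where "b / R < 2 ^ n" using real_arch_pow[of 2 "b / R"] by auto
  then have "b < 2 ^ n * R" using assms(2) by (simp add: divide_less_eq)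
  also have "\<dots> \<le> norm ((f ^^ n) v)" using *[of n] Finite_Cartesian_Product.norm_nth_le order_trans by blast
  finally show False using b[of n] by simp
qed

text \<open>
The cone contains an open neighbourhood of \<open>x\<close> when the dominant coordinate of \<open>x\<close> exceeds
\<open>R\<close>, and it contains no bounded orbit.
\<close>
lemma frontier_bounded_orbits_bound:
  assumes "doubles_cone i j R f" "R > 0" "x \<in> frontier (bounded_orbits f)"
    and "cmod (x $ j) \<le> cmod (x $ i)"
  shows "cmod (x $ i) \<le> R"
proof (rule ccontr)
  assume "\<not> cmod (x $ i) \<le> R"
  define U where "U = {x :: complex^2. R < cmod (x $ i)} \<inter> {x. cmod (x $ j) < 2 * cmod (x $ i)}"
  have "open U" unfolding U_def by (intro open_Int open_Collect_less continuous_intros)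
  moreover have "x \<in> U" using \<open>\<not> cmod (x $ i) \<le> R\<close> assms by (auto simp: U_def)
  moreover have "U \<inter> bounded_orbits f = {}"
    using doubles_cone_unbounded[OF assms(1,2)] by (auto simp: U_def cone_def)
  ultimately have "x \<notin> closure (bounded_orbits f)"
    using open_Int_closure_eq_empty by blast
  then show False using assms(3) by (auto simp: frontier_def)
qed

lemma image_bounded_orbits:
  assumes "bij f" shows "f ` bounded_orbits f = bounded_orbits f"
proof (intro equalityI subsetI)
  fix y assume "y \<in> f ` bounded_orbits f"
  then obtain x where x: "y = f x" "bounded (range (\<lambda>n. (f ^^ n) x))" by auto
  have "range (\<lambda>n. (f ^^ n) y) \<subseteq> range (\<lambda>n. (f ^^ n) x)"
  proof clarify
    fix n show "(f ^^ n) y \<in> range (\<lambda>n. (f ^^ n) x)"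
      by (rule range_eqI[of _ _ "Suc n"]) (simp add: x funpow_swap1)
  qed
  then show "y \<in> bounded_orbits f" using x bounded_subset by auto
next
  fix y assume "y \<in> bounded_orbits f"
  moreover have "range (\<lambda>n. (f ^^ n) (inv f y)) \<subseteq> insert (inv f y) (range (\<lambda>n. (f ^^ n) y))"
  proof clarify
    fix n assume "(f ^^ n) (inv f y) \<notin> range (\<lambda>n. (f ^^ n) y)"
    moreover have "(f ^^ Suc m) (inv f y) = (f ^^ m) y" for m
      using assms by (simp add: funpow_swap1 bij_is_surj surj_f_inv_f)
    ultimately show "(f ^^ n) (inv f y) = inv f y" by (cases n) (auto simp del: funpow.simps)
  qed
  ultimately have "bounded (range (\<lambda>n. (f ^^ n) (inv f y)))"
    by (metis bounded_insert bounded_subset mem_Collect_eq)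
  then have "inv f y \<in> bounded_orbits f" by simp
  then show "y \<in> f ` bounded_orbits f"
    using assms by (intro image_eqI[of _ _ "inv f y"]) (auto simp: bij_is_surj surj_f_inv_f)
qed

lemma image_frontier:
  fixes f :: "'a::topological_space \<Rightarrow> 'a"
  assumes "bij f" "continuous_on UNIV f" "continuous_on UNIV (inv f)" "f ` S = S"
  shows "f ` frontier S = frontier S"
proof -
  have *: "g ` frontier S \<subseteq> frontier S" if g: "bij g" "continuous_on UNIV g" "g ` S = S" for g :: "'a \<Rightarrow> 'a"
  proof -
    have "g ` (- S) = - S" using bij_image_Compl_eq[OF g(1)] g(3) by simp
    moreover have "g ` closure X \<subseteq> closure (g ` X)" for X
      using g(2) by (meson continuous_image_closure_subset subset_UNIV)
    ultimately show ?thesis using g(3) unfolding frontier_closures by (metis image_Int_subset Int_mono order_trans)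
  qed
  have "inv f ` S = S" using assms by (metis bij_is_inj image_inv_f_f)
  from *[OF bij_imp_bij_inv[OF assms(1)] assms(3) this]
  have "f ` (inv f ` frontier S) \<subseteq> f ` frontier S" by (rule image_mono)
  then have "frontier S \<subseteq> f ` frontier S" using assms by (simp add: bij_is_surj image_f_inv_f)
  with *[OF assms(1,2,4)] show ?thesis by blast
qed

lemma compact_julia:
  assumes "henon_map f" shows "compact (julia f)"
proof -
  obtain R where R: "R > 0" "doubles_cone 2 1 R f" "doubles_cone 1 2 R (inv f)"
    using henon_map_structure[OF assms] by blast
  have "norm x \<le> 2 * R" if "x \<in> julia f" for x
  proof -
    have x: "x \<in> frontier (bounded_orbits f)" "x \<in> frontier (bounded_orbits (inv f))"
      using that by (auto simp: julia_def J_plus_def J_minus_def K_plus_def K_minus_def)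
    have "cmod (x $ 1) \<le> R \<and> cmod (x $ 2) \<le> R"
      using frontier_bounded_orbits_bound[OF R(2,1) x(1)]
        frontier_bounded_orbits_bound[OF R(3,1) x(2)] by linarith
    moreover have "norm x \<le> cmod (x $ 1) + cmod (x $ 2)"
      unfolding norm_vec_def using L2_set_le_sum[of UNIV "\<lambda>i. norm (x $ i)"] by (simp add: sum_2)
    ultimately show ?thesis by simp
  qed
  then have "bounded (julia f)" by (auto simp: bounded_iff)
  moreover have "closed (julia f)" by (auto simp: julia_def J_plus_def J_minus_def)
  ultimately show ?thesis by (simp add: compact_eq_bounded_closed)
qed

lemma image_julia:
  assumes "henon_map f" shows "f ` julia f = julia f"
proof -
  have f: "bij f" "C1 f" "C1 (inv f)" using henon_map_structure[OF assms] by auto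
  note cont = f(1) C1_continuous[OF f(2)] C1_continuous[OF f(3)]
  have p: "f ` J_plus f = J_plus f"
    unfolding J_plus_def K_plus_def by (intro image_frontier cont image_bounded_orbits)
  have "inv f ` bounded_orbits (inv f) = bounded_orbits (inv f)"
    by (intro image_bounded_orbits bij_imp_bij_inv f)
  then have "f ` bounded_orbits (inv f) = bounded_orbits (inv f)"
    using f(1) by (metis bij_is_surj image_f_inv_f)
  then have m: "f ` J_minus f = J_minus f"
    unfolding J_minus_def K_minus_def by (intro image_frontier cont)
  show ?thesis unfolding julia_def using f(1) p m by (simp add: image_Int bij_is_inj)
qed

section \<open>Norms on lines and planes\<close>
lemma onorm_on_bound:
  assumes "bounded_linear A" "v \<in> V"
  shows "norm (A v) \<le> onorm_on V A * norm v"
proof (cases "v = 0")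
  case True
  then show ?thesis using assms(1) by (simp add: linear_0 bounded_linear.linear)
next
  case False
  have "bdd_above ((\<lambda>v. norm (A v) / norm v) ` V)"
    using le_onorm[OF assms(1)] by (auto intro!: bdd_aboveI[of _ "onorm A"])
  then have "norm (A v) / norm v \<le> onorm_on V A"
    unfolding onorm_on_def using assms(2) by (rule cSUP_upper[rotated])
  then show ?thesis using False by (simp add: divide_le_eq)
qed

lemma onorm_on_least:
  assumes "V \<noteq> {}" "0 \<le> c" "\<And>v. v \<in> V \<Longrightarrow> norm (A v) \<le> c * norm v"
  shows "onorm_on V A \<le> c"
  unfolding onorm_on_def
proof (rule cSUP_least[OF assms(1)])
  fix v assume "v \<in> V"
  then show "norm (A v) / norm v \<le> c" using assms(2,3) by (cases "v = 0") (auto simp: divide_le_eq)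
qed

lemma norm_vector_smult: "norm (c *s v) = cmod c * norm v" for v :: "complex^'n"
  by (simp add: norm_vec_def norm_mult L2_set_right_distrib)

lemma norm_le_sum_2: "norm x \<le> norm (x $ 1) + norm (x $ 2)"
  for x :: "'a::real_normed_vector^2"
  unfolding norm_vec_def using L2_set_le_sum[of UNIV "\<lambda>i. norm (x $ i)"] by (simp add: sum_2)

lemma norm_matrix_vector_le: "norm (A *v v) \<le> 4 * norm A * norm v" for A :: "complex^2^2"
proof -
  have c: "cmod (A $ i $ j * v $ j) \<le> norm A * norm v" for i j
  proof -
    have "cmod (A $ i $ j) \<le> norm A"
      using Finite_Cartesian_Product.norm_nth_le[of "A $ i" j]
        Finite_Cartesian_Product.norm_nth_le[of A i] by linarith
    then show ?thesis
      unfolding norm_mult by (rule mult_mono) (auto simp: Finite_Cartesian_Product.norm_nth_le)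
  qed
  have "cmod (A $ i $ 1 * v $ 1 + A $ i $ 2 * v $ 2) \<le> 2 * (norm A * norm v)" for i
    using norm_triangle_mono[OF c[of i 1] c[of i 2]] by linarith
  from this[of 1] this[of 2] show ?thesis
    using norm_le_sum_2[of "A *v v"] by (simp add: matrix_vector_mult_2)
qed

lemma line_eq:
  assumes "vec.subspace V" "vec.dim V = 1" "v \<in> V" "v \<noteq> 0"
  shows "V = range (\<lambda>c. c *s v)"
proof -
  have "V \<subseteq> vec.span {v}"
    using assms vec.card_eq_dim[of "{v}" V] by (simp add: vec.independent_insert vec.dependent_single)
  moreover have "vec.span {v} \<subseteq> V" using assms by (intro vec.span_minimal) auto
  ultimately show ?thesis by (simp add: vec.span_singleton)
qed

section \<open>Complex areas\<close>

text \<open>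
The complex area of the parallelogram spanned by two vectors.
\<close>
definition det2 :: "complex^2 \<Rightarrow> complex^2 \<Rightarrow> complex" where
  "det2 u v = u $ 1 * v $ 2 - u $ 2 * v $ 1"

lemma det2_matrix: "det2 (A *v u) (A *v v) = det A * det2 u v"
  by (simp add: det2_def det_2 matrix_vector_mult_2 algebra_simps)

lemma det2_le: "cmod (det2 u v) \<le> 2 * norm u * norm v"
proof -
  have "cmod (u $ i * v $ j) \<le> norm u * norm v" for i j
    unfolding norm_mult by (rule mult_mono) (auto simp: Finite_Cartesian_Product.norm_nth_le)
  from this[of 1 2] this[of 2 1] show ?thesis
    unfolding det2_def using norm_triangle_ineq4[of "u $ 1 * v $ 2" "u $ 2 * v $ 1"] by linarith
qed

lemma norm_vec2_power2: "(norm v)\<^sup>2 = (cmod (v $ 1))\<^sup>2 + (cmod (v $ 2))\<^sup>2" for v :: "complex^2"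
  by (simp add: norm_vec_def L2_set_def sum_2)

text \<open>
A lower bound for the angle between two lines by the norm of the projection \<open>P\<close> onto the first
along the second.  Apply \<open>P\<close> to Cramer's identity
\<open>det2 u v *s w = det2 w v *s u + det2 u w *s v\<close>, with \<open>w\<close> orthogonal to \<open>v\<close> and of the same length, so that
\<open>det2 w v\<close> is the squared norm of \<open>v\<close>.
\<close>
lemma area_lower_bound:
  fixes P :: "complex^2^2"
  assumes P: "\<And>c d. P *v (c *s u + d *s v) = c *s u" and M: "\<And>w. norm (P *v w) \<le> M * norm w"
  shows "norm u * norm v \<le> M * cmod (det2 u v)"
proof (cases "v = 0")
  case False
  define w :: "complex^2" where "w = vector [cnj (v $ 2), - cnj (v $ 1)]"
  have "(norm w)\<^sup>2 = (norm v)\<^sup>2"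
    using norm_vec2_power2[of w] norm_vec2_power2[of v] by (simp add: w_def)
  then have nw: "norm w = norm v" by simp
  have wv: "det2 w v = of_real ((norm v)\<^sup>2)"
    unfolding norm_vec2_power2 by (simp add: det2_def w_def complex_norm_square mult.commute
        del: of_real_power)
  have "det2 u v *s w = det2 w v *s u + det2 u w *s v"
    by (simp add: vec_eq_iff forall_2 det2_def algebra_simps)
  then have "P *v (det2 u v *s w) = det2 w v *s u" using P by simp
  then have "norm (det2 w v *s u) = cmod (det2 u v) * norm (P *v w)"
    by (metis norm_vector_smult vector_scalar_commute)
  also have "\<dots> \<le> cmod (det2 u v) * (M * norm v)"
    using M[of w] by (intro mult_left_mono) (auto simp: nw)
  finally have "norm v * (norm u * norm v) \<le> norm v * (M * cmod (det2 u v))"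
    by (simp add: norm_vector_smult wv power2_eq_square norm_mult mult_ac)
  then show ?thesis using False by simp
qed (simp add: det2_def)

section \<open>The derivative cocycle over a compact invariant set\<close>

lemma bounded_linear_Df: "C1 f \<Longrightarrow> bounded_linear (Df f x)"
  using C1_has_derivative has_derivative_bounded_linear by blast

locale invariant_compact =
  fixes f :: "complex^2 \<Rightarrow> complex^2" and S
  assumes bij: "bij f" and C1: "C1 f" and C1_inv: "C1 (inv f)"
    and compact: "compact S" and image: "f ` S = S"
begin

lemma funpow_mem: "x \<in> S \<Longrightarrow> (f ^^ n) x \<in> S"
  using image by (induction n) auto

lemma inv_funpow_mem: "x \<in> S \<Longrightarrow> (inv f ^^ n) x \<in> S"
proof (induction n)
  case (Suc n)
  then obtain z where "z \<in> S" "(inv f ^^ n) x = f z" using image by blast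
  then show ?case using bij by (simp add: bij_is_inj)
qed simp

lemma inv_funpow_funpow: "(inv f ^^ n) ((f ^^ n) x) = x"
  unfolding inv_fn[OF bij, symmetric] by (rule inv_f_f[OF inj_fn[OF bij_is_inj[OF bij]]])

lemma funpow_inv_funpow: "(f ^^ n) ((inv f ^^ n) x) = x"
  unfolding inv_fn[OF bij, symmetric] by (rule surj_f_inv_f[OF bij_is_surj[OF bij_fn[OF bij]]])

lemma Df_Suc: "Df (f ^^ Suc n) x v = Df f ((f ^^ n) x) (Df (f ^^ n) x v)"
  using Df_compose[OF C1 C1_funpow[OF C1], of n x] by simp

lemma Df_0: "Df (f ^^ 0) x v = v"
  using Df_id[of x] by (simp add: id_def)

lemma Df_inv_Df: "Df (inv f ^^ n) ((f ^^ n) x) (Df (f ^^ n) x v) = v"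
proof -
  have "(inv f ^^ n) \<circ> (f ^^ n) = id" by (simp add: fun_eq_iff inv_funpow_funpow)
  then have "Df (inv f ^^ n) ((f ^^ n) x) \<circ> Df (f ^^ n) x = id"
    using Df_compose[OF C1_funpow[OF C1_inv] C1_funpow[OF C1], of n n x] by (simp only: Df_id)
  from fun_cong[OF this, of v] show ?thesis by simp
qed

lemma Df_eq_0: "Df (f ^^ n) x v = 0 \<Longrightarrow> v = 0"
  using Df_inv_Df[of n x v] linear_0[OF bounded_linear.linear[OF bounded_linear_Df[OF C1_funpow[OF C1_inv]]]]
  by simp

lemma Df_nonzero: "v \<noteq> 0 \<Longrightarrow> 0 < norm (Df (f ^^ n) x v)"
  using Df_eq_0 by auto

end

locale invariant_split = invariant_compact +
  fixes E F
  assumes split: "invariant_splitting f S E F"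
begin

lemma subspaces: "x \<in> S \<Longrightarrow> vec.subspace (E x)" "x \<in> S \<Longrightarrow> vec.subspace (F x)"
  using split by (auto simp: invariant_splitting_def continuous_splitting_def)

lemma zero_mem: "x \<in> S \<Longrightarrow> 0 \<in> E x" "x \<in> S \<Longrightarrow> 0 \<in> F x"
  using subspaces vec.subspace_0 by blast+

lemma decompose:
  assumes "x \<in> S" obtains u v where "u \<in> E x" "v \<in> F x" "w = u + v"
proof -
  have "{u + v | u v. u \<in> E x \<and> v \<in> F x} = UNIV"
    using split assms by (simp add: invariant_splitting_def continuous_splitting_def)
  then have "w \<in> {u + v | u v. u \<in> E x \<and> v \<in> F x}" by simp
  then show ?thesis using that by blast
qed

lemma Df_image:
  assumes "x \<in> S"
  shows "Df (f ^^ n) x ` E x = E ((f ^^ n) x)" "Df (f ^^ n) x ` F x = F ((f ^^ n) x)"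
proof (induction n)
  case 0
  { case 1 then show ?case using Df_0[of x] by (simp add: image_def) }
  { case 2 then show ?case using Df_0[of x] by (simp add: image_def) }
next
  case (Suc n)
  have D: "Df (f ^^ Suc n) x = Df f ((f ^^ n) x) \<circ> Df (f ^^ n) x"
    by (simp add: fun_eq_iff Df_Suc del: funpow.simps)
  have I: "Df f ((f ^^ n) x) ` E ((f ^^ n) x) = E (f ((f ^^ n) x))"
    "Df f ((f ^^ n) x) ` F ((f ^^ n) x) = F (f ((f ^^ n) x))"
    using split funpow_mem[OF assms] by (auto simp: invariant_splitting_def)
  { case 1 show ?case unfolding D image_comp[symmetric] Suc I by simp }
  { case 2 show ?case unfolding D image_comp[symmetric] Suc I by simp }
qed

lemma Df_mem:
  assumes "x \<in> S"
  shows "v \<in> E x \<Longrightarrow> Df (f ^^ n) x v \<in> E ((f ^^ n) x)"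
    and "v \<in> F x \<Longrightarrow> Df (f ^^ n) x v \<in> F ((f ^^ n) x)"
  using Df_image[OF assms] by blast+

end

lemma (in invariant_compact) continuous_det_bound:
  assumes "\<And>x. cmod (det (matrix (Df f x))) < 1"
  shows "\<exists>d<1. 0 < d \<and> (\<forall>x\<in>S. cmod (det (matrix (Df f x))) \<le> d)"
proof (cases "S = {}")
  case False
  have "continuous_on S (\<lambda>x. cmod (det (matrix (Df f x))))"
    unfolding det_2
    by (intro continuous_intros continuous_on_subset[OF C1_continuous_Df[OF C1]]) auto
  from continuous_attains_sup[OF compact False this] obtain x where
    x: "\<And>y. y \<in> S \<Longrightarrow> cmod (det (matrix (Df f y))) \<le> cmod (det (matrix (Df f x)))" by blast
  then show ?thesis using assms[of x]
    by (intro exI[of _ "max (1/2) (cmod (det (matrix (Df f x))))"]) (auto simp: le_max_iff_disj)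
qed (auto intro: exI[of _ "1/2"])

locale dominated_split = invariant_split +
  fixes C lam
  assumes dimE: "\<And>x. x \<in> S \<Longrightarrow> vec.dim (E x) = 1"
    and dimF: "\<And>x. x \<in> S \<Longrightarrow> vec.dim (F x) = 1"
    and C: "C > 0" and lam: "0 < lam" "lam < 1"
    and dominated: "\<And>x n. x \<in> S \<Longrightarrow> onorm_on (E x) (Df (f ^^ n) x) *
          onorm_on (F ((f ^^ n) x)) (Df (inv f ^^ n) ((f ^^ n) x)) \<le> C * lam ^ n"
begin

lemma domination:
  assumes x: "x \<in> S" and u: "u \<in> E x" and v: "v \<in> F x"
  shows "norm (Df (f ^^ n) x u) * norm v \<le> C * lam ^ n * (norm u * norm (Df (f ^^ n) x v))"
proof -
  let ?oE = "onorm_on (E x) (Df (f ^^ n) x)"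
  let ?oF = "onorm_on (F ((f ^^ n) x)) (Df (inv f ^^ n) ((f ^^ n) x))"
  have 1: "norm (Df (f ^^ n) x u) \<le> ?oE * norm u"
    by (intro onorm_on_bound bounded_linear_Df C1_funpow C1 u)
  have "norm (Df (inv f ^^ n) ((f ^^ n) x) (Df (f ^^ n) x v)) \<le> ?oF * norm (Df (f ^^ n) x v)"
    by (intro onorm_on_bound bounded_linear_Df C1_funpow C1_inv Df_mem x v)
  then have 2: "norm v \<le> ?oF * norm (Df (f ^^ n) x v)" by (simp add: Df_inv_Df)
  have "norm (Df (f ^^ n) x u) * norm v \<le> (?oE * norm u) * (?oF * norm (Df (f ^^ n) x v))"
    by (rule mult_mono[OF 1 2]) (use 1 norm_ge_zero order_trans in blast)+
  also have "\<dots> = (?oE * ?oF) * (norm u * norm (Df (f ^^ n) x v))" by (simp add: mult_ac)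
  also have "\<dots> \<le> C * lam ^ n * (norm u * norm (Df (f ^^ n) x v))"
    by (intro mult_right_mono dominated x) auto
  finally show ?thesis .
qed

lemma F_nonzero: "x \<in> S \<Longrightarrow> \<exists>w. w \<in> F x \<and> w \<noteq> 0"
proof (rule ccontr)
  assume x: "x \<in> S" and "\<nexists>w. w \<in> F x \<and> w \<noteq> 0"
  then have "F x \<subseteq> {0}" by auto
  then show False using dimF[OF x] vec.dim_eq_0[of "F x"] by simp
qed

text \<open>The choice of the vector is immaterial, since \<open>F x\<close> is a complex line.\<close>

definition rate :: "complex^2 \<Rightarrow> real" where
  "rate x = (let w = (SOME w. w \<in> F x \<and> w \<noteq> 0) in ln (norm (Df f x w) / norm w))"

lemma norm_Df_F:
  assumes x: "x \<in> S" and v: "v \<in> F x"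
  shows "norm (Df f x v) = exp (rate x) * norm v"
proof -
  define w where "w = (SOME w. w \<in> F x \<and> w \<noteq> 0)"
  have w: "w \<in> F x" "w \<noteq> 0" unfolding w_def using someI_ex[OF F_nonzero[OF x]] by auto
  have "0 < norm (Df f x w)" using Df_nonzero[OF w(2), of 1 x] by simp
  then have r: "exp (rate x) = norm (Df f x w) / norm w"
    using w by (simp add: rate_def w_def[symmetric])
  obtain c where "v = c *s w" using line_eq[OF subspaces(2) dimF w] x v by blast
  then show ?thesis using w by (simp add: r Df_scale[OF C1] norm_vector_smult)
qed

lemma norm_Df_F_funpow:
  assumes x: "x \<in> S" and v: "v \<in> F x"
  shows "norm (Df (f ^^ n) x v) = exp (\<Sum>i<n. rate ((f ^^ i) x)) * norm v"
proof (induction n)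
  case (Suc n)
  then show ?case
    using norm_Df_F[OF funpow_mem[OF x] Df_mem(2)[OF x v]]
    by (simp add: Df_Suc exp_add del: funpow.simps)
qed (use Df_0 in simp)

text \<open>
Near \<open>x0\<close> the vector of \<open>F x\<close> that defines the rate may be chosen continuously: project a fixed
vector of \<open>F x0\<close> to \<open>F x\<close> along \<open>E x\<close>.
\<close>
lemma continuous_rate: "continuous_on S rate"
  unfolding continuous_on_def
proof
  fix x0 assume x0: "x0 \<in> S"
  obtain P where P: "continuous_on S P" "\<And>x u v. x \<in> S \<Longrightarrow> u \<in> E x \<Longrightarrow> v \<in> F x \<Longrightarrow> P x *v (u + v) = u"
    using split by (auto simp: invariant_splitting_def continuous_splitting_def)
  obtain w where w: "w \<in> F x0" "w \<noteq> 0" using F_nonzero[OF x0] by blast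
  define v where "v x = w - P x *v w" for x
  have vF: "v x \<in> F x" if x: "x \<in> S" for x
  proof -
    obtain u' v' where "u' \<in> E x" "v' \<in> F x" "w = u' + v'" using decompose[OF x, of w] by blast
    then show ?thesis using P(2)[OF x, of u' v'] by (simp add: v_def)
  qed
  have v0: "v x0 = w"
    using P(2)[OF x0 zero_mem(1)[OF x0] w(1)] by (simp add: v_def)
  have vc: "continuous_on S v" unfolding v_def
    by (intro continuous_intros continuous_on_matrix_vector_mult P)
  define h where "h x = ln (norm (matrix (Df f x) *v v x) / norm (v x))" for x
  have "continuous_on S (\<lambda>x. norm (matrix (Df f x) *v v x))"
    by (intro continuous_intros continuous_on_matrix_vector_mult vc
        continuous_on_subset[OF C1_continuous_Df[OF C1]]) auto
  then have t1: "((\<lambda>x. norm (matrix (Df f x) *v v x)) \<longlongrightarrow> norm (matrix (Df f x0) *v v x0)) (at x0 within S)"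
    using x0 by (auto simp: continuous_on_def)
  have t2: "(v \<longlongrightarrow> v x0) (at x0 within S)"
    using vc x0 by (auto simp: continuous_on_def)
  have Dv: "matrix (Df f x) *v u = Df f x u" for x u
    using fun_cong[OF C1_Df[OF C1, of x], of u] by (rule sym)
  have n0: "norm (matrix (Df f x0) *v v x0) > 0"
    unfolding Dv using Df_nonzero[of "v x0" 1 x0] w v0 by simp
  have "(h \<longlongrightarrow> h x0) (at x0 within S)"
    unfolding h_def by (intro tendsto_ln tendsto_divide tendsto_norm t1 t2) (use n0 w v0 in auto)
  moreover have hr: "h x = rate x" if "x \<in> S" "v x \<noteq> 0" for x
    using norm_Df_F[OF that(1) vF[OF that(1)]] that(2) by (simp add: h_def Dv)
  moreover have "eventually (\<lambda>x. h x = rate x) (at x0 within S)"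
  proof -
    have "eventually (\<lambda>x. v x \<noteq> 0) (at x0 within S)"
      using t2 w v0 by (intro tendsto_imp_eventually_ne) auto
    moreover have "eventually (\<lambda>x. x \<in> S) (at x0 within S)" by (simp add: eventually_at_filter)
    ultimately show ?thesis by eventually_elim (rule hr)
  qed
  ultimately show "(rate \<longlongrightarrow> rate x0) (at x0 within S)"
    using hr[OF x0] w v0 by (simp add: tendsto_cong)
qed

text \<open>
For \<open>u\<close> in \<open>E x\<close> and \<open>v\<close> in \<open>F x\<close> let \<open>a\<close> and \<open>c\<close> be the norms of their images.  The area estimate bounds
\<open>a * c\<close> by a multiple of \<open>d ^ n\<close> and domination bounds \<open>a / c\<close> by a multiple of \<open>lam ^ n\<close>; the
product of the two bounds \<open>a\<^sup>2\<close>.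
\<close>
lemma E_contracted:
  assumes d: "0 < d" "d < 1" "\<And>x. x \<in> S \<Longrightarrow> cmod (det (matrix (Df f x))) \<le> d"
  shows "\<exists>K>0. \<forall>x\<in>S. \<forall>u\<in>E x. \<forall>n. norm (Df (f ^^ n) x u) \<le> K * sqrt (lam * d) ^ n * norm u"
proof -
  obtain P where P: "continuous_on S P" "\<And>x u v. x \<in> S \<Longrightarrow> u \<in> E x \<Longrightarrow> v \<in> F x \<Longrightarrow> P x *v (u + v) = u"
    using split by (auto simp: invariant_splitting_def continuous_splitting_def)
  have "bounded (P ` S)" using compact P(1) by (intro compact_imp_bounded compact_continuous_image)
  then obtain b where b: "b > 0" "\<And>x. x \<in> S \<Longrightarrow> norm (P x) \<le> b" by (auto simp: bounded_pos)
  define M where "M = 4 * b"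
  have M: "M > 0" using b by (simp add: M_def)
  have area: "norm u * norm v \<le> M * cmod (det2 u v)" if "x \<in> S" "u \<in> E x" "v \<in> F x" for x u v
  proof (rule area_lower_bound[of "P x"])
    show "P x *v (c *s u + e *s v) = c *s u" for c e
      using that subspaces by (intro P(2)) (auto intro: vec.subspace_scale)
    show "norm (P x *v w) \<le> M * norm w" for w
      unfolding M_def using b(2)[OF that(1)]
      by (intro order_trans[OF norm_matrix_vector_le] mult_right_mono) auto
  qed
  have detn: "cmod (det2 (Df (f ^^ n) x u) (Df (f ^^ n) x v)) \<le> d ^ n * cmod (det2 u v)"
    if "x \<in> S" for x u v n
  proof (induction n)
    case (Suc n)
    have "det2 (Df (f ^^ Suc n) x u) (Df (f ^^ Suc n) x v)
      = det (matrix (Df f ((f ^^ n) x))) * det2 (Df (f ^^ n) x u) (Df (f ^^ n) x v)"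
      unfolding Df_Suc by (subst (1 2) C1_Df[OF C1]) (rule det2_matrix)
    then have "cmod (det2 (Df (f ^^ Suc n) x u) (Df (f ^^ Suc n) x v))
      = cmod (det (matrix (Df f ((f ^^ n) x)))) * cmod (det2 (Df (f ^^ n) x u) (Df (f ^^ n) x v))"
      by (simp only: norm_mult)
    also have "\<dots> \<le> d * (d ^ n * cmod (det2 u v))"
      by (rule mult_mono[OF d(3)[OF funpow_mem[OF that]] Suc]) (use d(1) in auto)
    finally show ?case by (simp add: mult_ac del: funpow.simps)
  qed (use Df_0 in simp)
  define K where "K = sqrt (2 * M * C)"
  have K: "K > 0" using M C by (simp add: K_def)
  have "norm (Df (f ^^ n) x u) \<le> K * sqrt (lam * d) ^ n * norm u"
    if x: "x \<in> S" and u: "u \<in> E x" for x u n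
  proof -
    obtain v where v: "v \<in> F x" "v \<noteq> 0" using F_nonzero[OF x] by blast
    define a where "a = norm (Df (f ^^ n) x u)"
    define c where "c = norm (Df (f ^^ n) x v)"
    have c: "c > 0" unfolding c_def using Df_nonzero[OF v(2)] .
    have "a * c \<le> M * cmod (det2 (Df (f ^^ n) x u) (Df (f ^^ n) x v))"
      unfolding a_def c_def by (intro area[of "(f ^^ n) x"] funpow_mem Df_mem x u v)
    also have "\<dots> \<le> M * (d ^ n * (2 * norm u * norm v))"
      using detn[OF x, of n u v] det2_le[of u v] M d(1)
      by (intro mult_left_mono order_trans[OF detn[OF x]]) auto
    finally have 1: "a * c \<le> M * (d ^ n * (2 * norm u * norm v))" .
    have 2: "a * norm v \<le> C * lam ^ n * (norm u * c)"
      unfolding a_def c_def by (rule domination[OF x u v(1)])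
    have "(a * c) * (a * norm v) \<le> (M * (d ^ n * (2 * norm u * norm v))) * (C * lam ^ n * (norm u * c))"
      by (rule mult_mono[OF 1 2]) (use c M d(1) in \<open>auto simp: a_def\<close>)
    then have "(c * norm v) * a\<^sup>2 \<le> (c * norm v) * (2 * M * C * (lam * d) ^ n * (norm u)\<^sup>2)"
      by (simp add: power2_eq_square power_mult_distrib mult_ac)
    then have "a\<^sup>2 \<le> 2 * M * C * (lam * d) ^ n * (norm u)\<^sup>2" using c v by simp
    then have "sqrt (a\<^sup>2) \<le> sqrt (2 * M * C * (lam * d) ^ n * (norm u)\<^sup>2)" by (rule real_sqrt_le_mono)
    then show ?thesis by (simp add: K_def real_sqrt_mult real_sqrt_power a_def)
  qed
  then show ?thesis using K by blast
qed

text \<open>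
By domination, a vector grows at most like a constant times the growth along \<open>F\<close>, whatever
its component in \<open>E\<close>.
\<close>
lemma lyap_plus_le:
  assumes x: "x \<in> S"
  shows "lyap_plus f x \<le> limsup (\<lambda>n. ereal ((\<Sum>i<n. rate ((f ^^ i) x)) / n))"
  unfolding lyap_plus_def
proof (rule SUP_least)
  fix z :: "complex^2" assume "z \<in> - {0}"
  then have z0: "z \<noteq> 0" by simp
  obtain u v where uv: "u \<in> E x" "v \<in> F x" "z = u + v" using decompose[OF x] by metis
  obtain w where w: "w \<in> F x" "w \<noteq> 0" using F_nonzero[OF x] by blast
  define K where "K = C * norm u + norm v"
  have K: "K > 0" unfolding K_def using z0 C uv(3)
    by (cases "v = 0") (auto intro: add_nonneg_pos)
  let ?s = "\<lambda>n. \<Sum>i<n. rate ((f ^^ i) x)"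
  have bound: "norm (Df (f ^^ n) x z) \<le> K * exp (?s n)" for n
  proof -
    have "norm (Df (f ^^ n) x u) * norm w \<le> C * lam ^ n * (norm u * (exp (?s n) * norm w))"
      using domination[OF x uv(1) w(1), of n] norm_Df_F_funpow[OF x w(1), of n] by simp
    also have "\<dots> \<le> C * 1 * (norm u * (exp (?s n) * norm w))"
      using C lam by (intro mult_right_mono mult_left_mono power_le_one) auto
    finally have "norm (Df (f ^^ n) x u) \<le> C * norm u * exp (?s n)"
      using w(2) by (simp add: mult_ac)
    moreover have "norm (Df (f ^^ n) x v) = exp (?s n) * norm v" by (rule norm_Df_F_funpow[OF x uv(2)])
    moreover have "norm (Df (f ^^ n) x z) \<le> norm (Df (f ^^ n) x u) + norm (Df (f ^^ n) x v)"
      unfolding uv(3) Df_add[OF C1_funpow[OF C1]] by (rule norm_triangle_ineq)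
    ultimately show ?thesis by (simp add: K_def algebra_simps)
  qed
  have ln: "ln (norm (Df (f ^^ n) x z)) / n \<le> ln K / n + ?s n / n" for n
  proof -
    have "ln (norm (Df (f ^^ n) x z)) \<le> ln (K * exp (?s n))"
      using bound[of n] Df_nonzero[OF z0] by (subst ln_le_cancel_iff) (use K in auto)
    also have "\<dots> = ln K + ?s n" using K by (simp add: ln_mult)
    finally show ?thesis by (simp add: divide_right_mono flip: add_divide_distrib)
  qed
  have "lyapunov_exponent f x z \<le> limsup (\<lambda>n. ereal (ln K / n) + ereal (?s n / n))"
    unfolding lyapunov_exponent_def
    by (intro Limsup_mono always_eventually allI) (use ln in simp)
  also have "\<dots> = 0 + limsup (\<lambda>n. ereal (?s n / n))"
    by (rule ereal_limsup_lim_add) (use lim_const_over_n[of "ln K"] in \<open>simp_all add: zero_ereal_def\<close>)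
  finally show "lyapunov_exponent f x z \<le> limsup (\<lambda>n. ereal (?s n / n))" by simp
qed

end

section \<open>Hyperbolic measures imply uniform hyperbolicity\<close>

text \<open>
Outside the support each point has a null neighbourhood, and by the Lindelof property countably
many of these suffice.
\<close>
lemma null_Compl_support:
  assumes "sets \<nu> = sets borel" "measure_support \<nu> \<subseteq> S"
  shows "emeasure \<nu> (- S) = 0"
proof -
  define \<U> where "\<U> = {U. open U \<and> emeasure \<nu> U = 0}"
  obtain \<V> where V: "\<V> \<subseteq> \<U>" "countable \<V>" "\<Union>\<V> = \<Union>\<U>"
    using Lindelof[of \<U>] by (auto simp: \<U>_def)
  have "(\<Union>U\<in>\<V>. U) \<in> null_sets \<nu>"
    using V(1,2) by (intro null_sets_UN') (auto simp: \<U>_def null_sets_def assms(1))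
  moreover have "- S \<subseteq> \<Union>\<U>"
  proof
    fix x assume "x \<in> - S"
    then have "x \<notin> measure_support \<nu>" using assms(2) by blast
    then show "x \<in> \<Union>\<U>" by (auto simp: measure_support_def \<U>_def)
  qed
  ultimately have "emeasure \<nu> (- S) \<le> emeasure \<nu> (\<Union>\<V>)"
    unfolding V(3)[symmetric] by (intro emeasure_mono) auto
  also have "\<dots> = 0" using \<open>(\<Union>U\<in>\<V>. U) \<in> null_sets \<nu>\<close> by auto
  finally show ?thesis by simp
qed

context dominated_split
begin

text \<open>
If there were no such \<open>N\<close>, orbit segments of every length with nonpositive sums would produce
an invariant measure with nonpositive mean rate.  The rate, which is meaningful on \<open>S\<close> only,
is extended continuously by Tietze's theorem.
\<close>
lemma uniform_expansion:
  assumes hyp: "\<And>\<nu>. invariant_probability f \<nu> \<Longrightarrow> measure_support \<nu> \<subseteq> S \<Longrightarrow> hyperbolic_measure f \<nu>"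
  shows "\<exists>N>0. \<forall>x\<in>S. 0 < (\<Sum>i<N. rate ((f ^^ i) x))"
proof (rule ccontr)
  assume "\<not> ?thesis"
  then have "\<forall>k. \<exists>y. y \<in> S \<and> (\<Sum>i<Suc k. rate ((f ^^ i) y)) \<le> 0"
    by (meson not_le zero_less_Suc)
  then obtain y where y: "\<And>k. y k \<in> S" "\<And>k. (\<Sum>i<Suc k. rate ((f ^^ i) (y k))) \<le> 0" by metis
  have fc: "continuous_on UNIV f" by (rule C1_continuous[OF C1])
  have "bounded (rate ` S)"
    using compact continuous_rate by (intro compact_imp_bounded compact_continuous_image)
  then obtain B where B: "\<And>x. x \<in> S \<Longrightarrow> norm (rate x) \<le> B" by (auto simp: bounded_iff)
  have B0: "0 \<le> B" using B[OF y(1)[of 0]] by (rule order_trans[OF norm_ge_zero])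
  obtain \<Phi> where \<Phi>: "continuous_on UNIV \<Phi>" "\<And>x. x \<in> S \<Longrightarrow> \<Phi> x = rate x" "\<And>x. norm (\<Phi> x) \<le> B"
    using Tietze[of S rate UNIV B, OF continuous_rate _ B0 B] compact
    by (auto simp: compact_imp_closed)
  have sum: "(\<Sum>i<n. \<Phi> ((f ^^ i) x)) = (\<Sum>i<n. rate ((f ^^ i) x))" if "x \<in> S" for n x
    by (intro sum.cong refl \<Phi>(2) funpow_mem that)
  have "\<exists>\<nu>. prob_space \<nu> \<and> sets \<nu> = sets borel \<and> distr \<nu> borel f = \<nu> \<and>
      emeasure \<nu> (- S) = 0 \<and> (\<integral>x. \<Phi> x \<partial>\<nu>) \<le> 0"
  proof (rule krylov_bogolyubov[OF compact fc _ \<Phi>(1) _ y(1)])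
    show "f ` S \<subseteq> S" using image by simp
    show "\<bar>\<Phi> x\<bar> \<le> B" for x using \<Phi>(3)[of x] by simp
    show "(\<Sum>i<Suc k. \<Phi> ((f ^^ i) (y k))) \<le> 0" for k
      unfolding sum[OF y(1)] by (rule y(2))
  qed
  then obtain \<nu> where \<nu>: "prob_space \<nu>" "sets \<nu> = sets borel" "distr \<nu> borel f = \<nu>"
    "emeasure \<nu> (- S) = 0" and le: "(\<integral>x. \<Phi> x \<partial>\<nu>) \<le> 0" by blast
  have "measure_support \<nu> \<subseteq> S"
  proof
    fix x assume x: "x \<in> measure_support \<nu>"
    have "open (- S)" using compact by (simp add: compact_imp_closed open_Compl)
    then show "x \<in> S" using x \<nu>(4) by (force simp: measure_support_def)
  qed
  then have "AE x in \<nu>. lyap_plus f x > 0"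
    using hyp[of \<nu>] \<nu> by (simp add: invariant_probability_def hyperbolic_measure_def)
  moreover have "AE x in \<nu>. x \<in> S"
    using \<nu>(2,4) compact
    by (intro AE_I[of _ _ "- S"]) (auto simp: compact_imp_closed borel_open open_Compl)
  ultimately have pos: "AE x in \<nu>. 0 < limsup (\<lambda>n. ereal ((\<Sum>i<n. \<Phi> ((f ^^ i) x)) / n))"
  proof eventually_elim
    case (elim x)
    show ?case unfolding sum[OF elim(2)] by (rule less_le_trans[OF elim(1) lyap_plus_le[OF elim(2)]])
  qed
  have "0 < (\<integral>x. \<Phi> x \<partial>\<nu>)"
  proof (rule integral_pos_of_limsup_average_pos[OF \<nu>(1) _ _ _ _ pos])
    show "f \<in> measurable \<nu> \<nu>"
      using borel_measurable_continuous_onI[OF fc] by (simp add: measurable_cong_sets[OF \<nu>(2) \<nu>(2)])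
    have "distr \<nu> \<nu> f = distr \<nu> borel f" by (rule distr_cong) (use \<nu>(2) in auto)
    then show "distr \<nu> \<nu> f = \<nu>" using \<nu>(3) by simp
    show "\<Phi> \<in> borel_measurable \<nu>"
      using borel_measurable_continuous_onI[OF \<Phi>(1)] by (simp add: measurable_cong_sets[OF \<nu>(2) refl])
    show "\<bar>\<Phi> x\<bar> \<le> B" for x using \<Phi>(3)[of x] by simp
  qed
  with le show False by simp
qed

text \<open>
Compactness gives a positive lower bound \<open>\<kappa>\<close> for the sums of length \<open>N\<close>; a long orbit segment is
cut into pieces of length \<open>N\<close>, and the remainder is absorbed by \<open>b\<close>.
\<close>
lemma linear_growth:
  assumes N: "N > 0" "\<And>x. x \<in> S \<Longrightarrow> 0 < (\<Sum>i<N. rate ((f ^^ i) x))"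
  shows "\<exists>a>0. \<exists>b. \<forall>x\<in>S. \<forall>n. a * real n - b \<le> (\<Sum>i<n. rate ((f ^^ i) x))"
proof (cases "S = {}")
  case False
  let ?s = "\<lambda>n x. \<Sum>i<n. rate ((f ^^ i) x)"
  have "continuous_on S (\<lambda>x. (f ^^ i) x)" for i
    by (rule continuous_on_subset[OF C1_continuous[OF C1_funpow[OF C1]]]) simp
  then have "continuous_on S (\<lambda>x. rate ((f ^^ i) x))" for i
    by (rule continuous_on_compose2[OF continuous_rate]) (use funpow_mem in blast)
  then have "continuous_on S (?s N)" by (intro continuous_intros)
  from continuous_attains_inf[OF compact False this] obtain x0 where
    x0: "x0 \<in> S" "\<And>x. x \<in> S \<Longrightarrow> ?s N x0 \<le> ?s N x" by blast
  define \<kappa> where "\<kappa> = ?s N x0"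
  have \<kappa>: "\<kappa> > 0" unfolding \<kappa>_def by (rule N(2)[OF x0(1)])
  have "bounded (rate ` S)"
    using compact continuous_rate by (intro compact_imp_bounded compact_continuous_image)
  then obtain B where B: "\<And>x. x \<in> S \<Longrightarrow> norm (rate x) \<le> B" by (auto simp: bounded_iff)
  have B0: "0 \<le> B" using B[OF x0(1)] by (rule order_trans[OF norm_ge_zero])
  have "\<forall>x\<in>S. \<kappa> / N * real n - (\<kappa> + N * B) \<le> ?s n x" for n
  proof (induction n rule: less_induct)
    case (less n)
    show ?case
    proof
      fix x assume x: "x \<in> S"
      show "\<kappa> / N * real n - (\<kappa> + N * B) \<le> ?s n x"
      proof (cases "n < N")
        case True
        have "(\<Sum>i<n. - B) \<le> ?s n x"
          by (rule sum_mono) (use B[OF funpow_mem[OF x]] in \<open>simp add: abs_le_iff minus_le_iff\<close>)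
        moreover have "real n * B \<le> real N * B" using True B0 by (intro mult_right_mono) auto
        moreover have "\<kappa> / N * real n \<le> \<kappa>"
          using True \<kappa> by (simp add: divide_le_eq mult_left_mono)
        ultimately show ?thesis by simp
      next
        case False
        then obtain m where m: "n = N + m" using le_iff_add[of N n] by auto
        have "?s n x = ?s N x + (\<Sum>i=N..<N+m. rate ((f ^^ i) x))"
          unfolding m by (simp add: sum.atLeastLessThan_concat lessThan_atLeast0)
        also have "(\<Sum>i=N..<N+m. rate ((f ^^ i) x)) = ?s m ((f ^^ N) x)"
          using sum.shift_bounds_nat_ivl[of "\<lambda>i. rate ((f ^^ i) x)" 0 N m]
          by (simp add: funpow_add lessThan_atLeast0 add.commute)
        finally have "?s n x = ?s N x + ?s m ((f ^^ N) x)" .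
        moreover have "\<kappa> \<le> ?s N x" unfolding \<kappa>_def by (rule x0(2)[OF x])
        moreover have "\<kappa> / N * real m - (\<kappa> + N * B) \<le> ?s m ((f ^^ N) x)"
          using less[of m] N(1) funpow_mem[OF x, of N] by (simp add: m)
        moreover have "\<kappa> / N * real n = \<kappa> + \<kappa> / N * real m"
          using N(1) by (simp add: m field_simps)
        ultimately show ?thesis by linarith
      qed
    qed
  qed
  then show ?thesis using \<kappa> N(1) by (intro exI[of _ "\<kappa> / N"] conjI exI[of _ "\<kappa> + N * B"]) auto
qed (auto intro: exI[of _ 1])

lemma hyperbolic_if:
  assumes diss: "dissipative f"
    and hyp: "\<And>\<nu>. invariant_probability f \<nu> \<Longrightarrow> measure_support \<nu> \<subseteq> S \<Longrightarrow> hyperbolic_measure f \<nu>"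
  shows "uniformly_hyperbolic f S"
proof -
  obtain d where d: "0 < d" "d < 1" "\<And>x. x \<in> S \<Longrightarrow> cmod (det (matrix (Df f x))) \<le> d"
    using continuous_det_bound diss unfolding dissipative_def by blast
  obtain K where K: "K > 0"
    "\<And>x u n. x \<in> S \<Longrightarrow> u \<in> E x \<Longrightarrow> norm (Df (f ^^ n) x u) \<le> K * sqrt (lam * d) ^ n * norm u"
    using E_contracted[OF d] by blast
  obtain N where "N > 0" "\<And>x. x \<in> S \<Longrightarrow> 0 < (\<Sum>i<N. rate ((f ^^ i) x))"
    using uniform_expansion[OF hyp] by blast
  then obtain a b where a: "a > 0" and
    ab: "\<And>x n. x \<in> S \<Longrightarrow> a * real n - b \<le> (\<Sum>i<n. rate ((f ^^ i) x))"
    using linear_growth[of N] by blast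
  define \<mu> where "\<mu> = max (sqrt (lam * d)) (exp (- a))"
  define M where "M = max K (exp b)"
  have "lam * d < 1 * 1" using lam d by (intro mult_strict_mono) auto
  then have \<mu>: "0 < \<mu>" "\<mu> < 1" using a lam d by (auto simp: \<mu>_def less_max_iff_disj)
  have M: "M > 0" using K(1) by (simp add: M_def)
  have s: "onorm_on (E x) (Df (f ^^ n) x) \<le> M * \<mu> ^ n" if x: "x \<in> S" for x n
  proof (rule onorm_on_least)
    show "E x \<noteq> {}" using zero_mem(1)[OF x] by blast
    show "0 \<le> M * \<mu> ^ n" using M \<mu> by simp
    fix u assume u: "u \<in> E x"
    have "K * sqrt (lam * d) ^ n \<le> M * \<mu> ^ n"
      using K(1) lam d by (intro mult_mono power_mono) (auto simp: M_def \<mu>_def)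
    then show "norm (Df (f ^^ n) x u) \<le> M * \<mu> ^ n * norm u"
      using K(2)[OF x u, of n] by (meson mult_right_mono norm_ge_zero order_trans)
  qed
  have t: "onorm_on (F x) (Df (inv f ^^ n) x) \<le> M * \<mu> ^ n" if x: "x \<in> S" for x n
  proof (rule onorm_on_least)
    show "F x \<noteq> {}" using zero_mem(2)[OF x] by blast
    show "0 \<le> M * \<mu> ^ n" using M \<mu> by simp
    fix v assume v: "v \<in> F x"
    define y where "y = (inv f ^^ n) x"
    have y: "y \<in> S" "(f ^^ n) y = x" using inv_funpow_mem[OF x] by (auto simp: y_def funpow_inv_funpow)
    obtain w where w: "w \<in> F y" "v = Df (f ^^ n) y w" using Df_image(2)[OF y(1), of n] v y(2) by blast
    have e: "Df (inv f ^^ n) x v = w" using Df_inv_Df[of n y w] by (simp add: w(2) y(2))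
    let ?s = "\<Sum>i<n. rate ((f ^^ i) y)"
    have nv: "norm v = exp ?s * norm w" using norm_Df_F_funpow[OF y(1) w(1), of n] by (simp add: w(2))
    have "norm w = exp (- ?s) * norm v" by (simp add: nv exp_minus)
    also have "\<dots> \<le> (exp b * exp (- a) ^ n) * norm v"
      using ab[OF y(1), of n]
      by (intro mult_right_mono) (auto simp: mult_exp_exp mult.commute simp flip: exp_of_nat_mult)
    also have "\<dots> \<le> (M * \<mu> ^ n) * norm v"
      by (intro mult_right_mono mult_mono power_mono) (auto simp: M_def \<mu>_def le_max_iff_disj)
    finally show "norm (Df (inv f ^^ n) x v) \<le> M * \<mu> ^ n * norm v" by (simp add: e)
  qed
  show ?thesis unfolding uniformly_hyperbolic_def
    using split M \<mu> s t by blast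
qed

end

section \<open>Uniform hyperbolicity implies hyperbolic measures\<close>
locale hyperbolic_split = invariant_split +
  fixes C lam
  assumes C: "C > 0" and lam: "0 < lam" "lam < 1"
    and stable: "\<And>x n. x \<in> S \<Longrightarrow> onorm_on (E x) (Df (f ^^ n) x) \<le> C * lam ^ n"
    and unstable: "\<And>x n. x \<in> S \<Longrightarrow> onorm_on (F x) (Df (inv f ^^ n) x) \<le> C * lam ^ n"
begin

lemma lyap_plus_pos:
  assumes x: "x \<in> S" and v: "v \<in> F x" "v \<noteq> 0"
  shows "0 < lyap_plus f x"
proof -
  have low: "- ln C / n - ln lam + ln (norm v) / n \<le> ln (norm (Df (f ^^ n) x v)) / n" if n: "n > 0" for n
  proof -
    let ?w = "Df (f ^^ n) x v"
    have w: "norm ?w > 0" by (rule Df_nonzero[OF v(2)])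
    have "norm (Df (inv f ^^ n) ((f ^^ n) x) ?w) \<le> onorm_on (F ((f ^^ n) x)) (Df (inv f ^^ n) ((f ^^ n) x)) * norm ?w"
      by (intro onorm_on_bound bounded_linear_Df C1_funpow C1_inv Df_mem x v)
    also have "\<dots> \<le> C * lam ^ n * norm ?w"
      by (intro mult_right_mono unstable funpow_mem x) auto
    finally have "norm v \<le> C * lam ^ n * norm ?w" by (simp add: Df_inv_Df)
    then have "ln (norm v) \<le> ln (C * lam ^ n * norm ?w)"
      using v C lam w by (subst ln_le_cancel_iff) auto
    also have "\<dots> = ln C + n * ln lam + ln (norm ?w)"
      using C lam w by (simp add: ln_mult ln_realpow)
    finally have "- ln C - n * ln lam + ln (norm v) \<le> ln (norm ?w)" by linarith
    then have "(- ln C - n * ln lam + ln (norm v)) / n \<le> ln (norm ?w) / n"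
      by (rule divide_right_mono) simp
    then show ?thesis using n by (simp add: add_divide_distrib diff_divide_distrib)
  qed
  have "(\<lambda>n. - ln C / n - ln lam + ln (norm v) / n) \<longlonglongrightarrow> 0 - ln lam + 0"
    by (intro tendsto_intros lim_const_over_n)
  then have "limsup (\<lambda>n. ereal (- ln C / n - ln lam + ln (norm v) / n)) = ereal (- ln lam)"
    by (intro lim_imp_Limsup) auto
  moreover have "limsup (\<lambda>n. ereal (- ln C / n - ln lam + ln (norm v) / n)) \<le> lyapunov_exponent f x v"
    unfolding lyapunov_exponent_def
    by (intro Limsup_mono eventually_sequentiallyI[of 1]) (use low in simp)
  moreover have "lyapunov_exponent f x v \<le> lyap_plus f x"
    unfolding lyap_plus_def by (rule SUP_upper) (use v in simp)
  ultimately have "ereal (- ln lam) \<le> lyap_plus f x" by simp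
  moreover have "0 < ereal (- ln lam)" using lam by simp
  ultimately show ?thesis by (rule less_le_trans[rotated])
qed

text \<open>
The orbit of \<open>x\<close> has only stable directions, so an iterate \<open>g\<close> contracts by \<open>1/2\<close> at all points of the
orbit.  Uniform continuity of the derivative yields contraction by \<open>3/4\<close> on balls of
a fixed radius \<open>\<delta>\<close> around these points, so \<open>g\<close> maps each ball into the next one and all
orbits that start in the first ball stay bounded.
\<close>
lemma attracting_interior:
  assumes x: "x \<in> S" and F0: "F x = {0}"
  shows "x \<in> interior (K_plus f)"
proof -
  define y where "y n = (f ^^ n) x" for n
  have yS: "y n \<in> S" for n unfolding y_def by (rule funpow_mem[OF x])
  have E: "E (y n) = UNIV" for n
  proof -
    have "F (y n) = Df (f ^^ n) x ` {0}" using Df_image(2)[OF x, of n] F0 by (simp add: y_def)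
    also have "\<dots> = {0}"
      using linear_0[OF bounded_linear.linear[OF bounded_linear_Df[OF C1_funpow[OF C1]]]] by simp
    finally have F: "F (y n) = {0}" .
    have "w \<in> E (y n)" for w using decompose[OF yS[of n], of w] F by force
    then show ?thesis by blast
  qed
  obtain N where N: "C * lam ^ N < 1 / 2"
  proof -
    have "(\<lambda>n. C * lam ^ n) \<longlonglongrightarrow> C * 0"
      using lam by (intro tendsto_intros LIMSEQ_power_zero) auto
    then have "eventually (\<lambda>n. C * lam ^ n < 1 / 2) sequentially"
      by (rule order_tendstoD(2)) simp
    then show ?thesis using that by (auto simp: eventually_sequentially)
  qed
  define M where "M = Suc N"
  define g where "g = f ^^ M"
  have g: "C1 g" unfolding g_def by (rule C1_funpow[OF C1])
  have "C * lam ^ M \<le> C * lam ^ N" using C lam by (simp add: M_def mult_left_le_one_le)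
  then have half: "norm (Df g (y n) v) \<le> 1 / 2 * norm v" for n v
  proof -
    have "norm (Df g (y n) v) \<le> onorm_on (E (y n)) (Df g (y n)) * norm v"
      by (intro onorm_on_bound bounded_linear_Df g) (simp add: E)
    also have "\<dots> \<le> 1 / 2 * norm v"
      using stable[OF yS, of n M] N \<open>C * lam ^ M \<le> C * lam ^ N\<close>
      by (intro mult_right_mono) (auto simp: g_def)
    finally show ?thesis .
  qed
  obtain R where R: "\<And>z. z \<in> S \<Longrightarrow> norm z \<le> R"
    using compact_imp_bounded[OF compact] by (auto simp: bounded_iff)
  let ?D = "\<lambda>z. matrix (Df g z)"
  have "uniformly_continuous_on (cball 0 (R + 1)) ?D"
    by (intro compact_uniformly_continuous compact_cball
        continuous_on_subset[OF C1_continuous_Df[OF g]]) auto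
  \<comment> \<open>\<open>norm_matrix_vector_le\<close> loses a factor \<open>4\<close>, so \<open>1/16\<close> costs \<open>1/4\<close> in operator norm.\<close>
  then obtain \<delta>0 where \<delta>0: "\<delta>0 > 0" "\<And>z z'. z \<in> cball 0 (R+1) \<Longrightarrow> z' \<in> cball 0 (R+1) \<Longrightarrow>
      dist z' z < \<delta>0 \<Longrightarrow> dist (?D z') (?D z) < 1 / 16"
    unfolding uniformly_continuous_on_def by (elim allE[of _ "1 / 16"]) auto
  define \<delta> where "\<delta> = min 1 \<delta>0"
  have \<delta>: "\<delta> > 0" using \<delta>0 by (simp add: \<delta>_def)
  have ballR: "z \<in> cball 0 (R + 1)" if "z \<in> ball (y n) \<delta>" for z n
  proof -
    have "norm z \<le> norm (y n) + norm (z - y n)" by (rule norm_triangle_sub)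
    also have "\<dots> \<le> R + 1" using R[OF yS[of n]] that by (auto simp: \<delta>_def dist_norm norm_minus_commute)
    finally show ?thesis by simp
  qed
  have step: "g z \<in> ball (g (y n)) \<delta>" if z: "z \<in> ball (y n) \<delta>" for z n
  proof -
    have on: "onorm (Df g w) \<le> 3 / 4" if w: "w \<in> ball (y n) \<delta>" for w
    proof (rule onorm_le)
      fix v :: "complex^2"
      have "y n \<in> ball (y n) \<delta>" using \<delta> by simp
      then have "norm (?D w - ?D (y n)) \<le> 1 / 16"
        using \<delta>0(2)[OF ballR ballR[OF w], of "y n" n] w
        by (auto simp: \<delta>_def dist_norm norm_minus_commute)
      then have "4 * norm (?D w - ?D (y n)) * norm v \<le> 4 * (1 / 16) * norm v"
        by (intro mult_right_mono mult_left_mono) auto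
      moreover have "norm ((?D w - ?D (y n)) *v v) \<le> 4 * norm (?D w - ?D (y n)) * norm v"
        by (rule norm_matrix_vector_le)
      moreover have "(?D w - ?D (y n)) *v v = Df g w v - Df g (y n) v"
        using fun_cong[OF C1_Df[OF g, of w], of v] fun_cong[OF C1_Df[OF g, of "y n"], of v]
        by (simp add: matrix_vector_mult_diff_rdistrib)
      ultimately have "norm (Df g w v - Df g (y n) v) \<le> 1 / 4 * norm v" by simp
      then show "norm (Df g w v) \<le> 3 / 4 * norm v"
        using half[of n v] norm_triangle_sub[of "Df g w v" "Df g (y n) v"] by linarith
    qed
    have "norm (g z - g (y n)) \<le> 3 / 4 * norm (z - y n)"
    proof (rule differentiable_bound[where S = "ball (y n) \<delta>" and f' = "Df g"])
      show "(g has_derivative Df g w) (at w within ball (y n) \<delta>)" for w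
        by (rule has_derivative_at_withinI[OF C1_has_derivative[OF g]])
    qed (use on z \<delta> in auto)
    moreover have "norm (z - y n) < \<delta>" using z by (simp add: dist_norm norm_minus_commute)
    ultimately have "norm (g z - g (y n)) < \<delta>" using norm_ge_zero[of "z - y n"] by linarith
    then show ?thesis by (simp add: dist_norm norm_minus_commute)
  qed
  have gy: "g (y n) = y (n + M)" for n
    by (simp add: g_def y_def funpow_add add.commute[of n] del: funpow.simps)
  have orbit: "(g ^^ k) z \<in> cball 0 (R + 1)" if "z \<in> ball x \<delta>" for z k
  proof -
    have "(g ^^ k) z \<in> ball (y (k * M)) \<delta>"
    proof (induction k)
      case 0 then show ?case using that by (simp add: y_def)
    next
      case (Suc k) then show ?case using step[OF Suc] by (simp add: gy add.commute)
    qed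
    then show ?thesis by (rule ballR)
  qed
  have "ball x \<delta> \<subseteq> K_plus f"
  proof
    fix z assume z: "z \<in> ball x \<delta>"
    have "range (\<lambda>n. (f ^^ n) z) \<subseteq> (\<Union>r<M. (f ^^ r) ` cball 0 (R + 1))"
    proof clarify
      fix n
      have "(f ^^ n) z = (f ^^ (n mod M + M * (n div M))) z" by simp
      also have "\<dots> = (f ^^ (n mod M)) ((g ^^ (n div M)) z)"
        unfolding g_def funpow_mult funpow_add by simp
      finally have "(f ^^ n) z = (f ^^ (n mod M)) ((g ^^ (n div M)) z)" .
      moreover have "n mod M < M" by (simp add: M_def)
      ultimately show "(f ^^ n) z \<in> (\<Union>r<M. (f ^^ r) ` cball 0 (R + 1))"
        using orbit[OF z] by blast
    qed
    moreover have "bounded (\<Union>r<M. (f ^^ r) ` cball 0 (R + 1))"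
      by (intro bounded_UN ballI compact_imp_bounded compact_continuous_image compact_cball
        continuous_on_subset[OF C1_continuous[OF C1_funpow[OF C1]]]) auto
    ultimately show "z \<in> K_plus f" unfolding K_plus_def using bounded_subset by blast
  qed
  then show ?thesis using \<delta> by (meson interior_maximal open_ball centre_in_ball subsetD)
qed

end

lemma measure_hyperbolic_if:
  assumes "henon_map f" "uniformly_hyperbolic f (julia f)"
    and \<nu>: "invariant_probability f \<nu>" "measure_support \<nu> \<subseteq> julia f"
  shows "hyperbolic_measure f \<nu>"
proof -
  obtain E F C lam where EF: "invariant_splitting f (julia f) E F" "C > 0" "0 < lam" "lam < 1"
    "\<And>x n. x \<in> julia f \<Longrightarrow> onorm_on (E x) (Df (f ^^ n) x) \<le> C * lam ^ n"
    "\<And>x n. x \<in> julia f \<Longrightarrow> onorm_on (F x) (Df (inv f ^^ n) x) \<le> C * lam ^ n"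
    using assms(2) unfolding uniformly_hyperbolic_def by blast
  interpret hyperbolic_split f "julia f" E F C lam
    using henon_map_structure[OF assms(1)] compact_julia[OF assms(1)] image_julia[OF assms(1)] EF
    by unfold_locales auto
  have pos: "0 < lyap_plus f x" if x: "x \<in> julia f" for x
  proof -
    have "F x \<noteq> {0}"
    proof
      assume "F x = {0}"
      from attracting_interior[OF x this] show False
        using x by (simp add: julia_def J_plus_def frontier_def)
    qed
    then obtain v where "v \<in> F x" "v \<noteq> 0" using zero_mem(2)[OF x] by blast
    then show ?thesis by (rule lyap_plus_pos[OF x])
  qed
  have s: "sets \<nu> = sets borel" using \<nu>(1) by (simp add: invariant_probability_def)
  show ?thesis unfolding hyperbolic_measure_def
  proof (rule AE_I[of _ _ "- julia f"])
    show "emeasure \<nu> (- julia f) = 0" by (rule null_Compl_support[OF s \<nu>(2)])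
    show "- julia f \<in> sets \<nu>"
      using compact by (simp add: s compact_imp_closed borel_open open_Compl)
  qed (use pos in auto)
qed

theorem corollaryC:
  fixes f :: "complex^2 \<Rightarrow> complex^2"
  assumes "henon_map f"
    and "dissipative f"
    and "has_dominated_splitting f (julia f)"
  shows "uniformly_hyperbolic f (julia f) \<longleftrightarrow>
    (\<forall>\<nu>. invariant_probability f \<nu> \<and> measure_support \<nu> \<subseteq> julia f \<longrightarrow> hyperbolic_measure f \<nu>)"
proof
  assume "uniformly_hyperbolic f (julia f)"
  then show "\<forall>\<nu>. invariant_probability f \<nu> \<and> measure_support \<nu> \<subseteq> julia f \<longrightarrow> hyperbolic_measure f \<nu>"
    using measure_hyperbolic_if[OF assms(1)] by blast
next
  assume hyp: "\<forall>\<nu>. invariant_probability f \<nu> \<and> measure_support \<nu> \<subseteq> julia f \<longrightarrow> hyperbolic_measure f \<nu>"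
  obtain E F C lam where EF: "invariant_splitting f (julia f) E F"
    "\<And>x. x \<in> julia f \<Longrightarrow> vec.dim (E x) = 1" "\<And>x. x \<in> julia f \<Longrightarrow> vec.dim (F x) = 1"
    "C > 0" "0 < lam" "lam < 1"
    "\<And>x n. x \<in> julia f \<Longrightarrow> onorm_on (E x) (Df (f ^^ n) x) *
          onorm_on (F ((f ^^ n) x)) (Df (inv f ^^ n) ((f ^^ n) x)) \<le> C * lam ^ n"
    using assms(3) unfolding has_dominated_splitting_def by metis
  interpret dominated_split f "julia f" E F C lam
    using henon_map_structure[OF assms(1)] compact_julia[OF assms(1)] image_julia[OF assms(1)] EF
    by unfold_locales auto
  show "uniformly_hyperbolic f (julia f)" using hyperbolic_if[OF assms(2)] hyp by blast
qed

end
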